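(* Suppose that $f(\cdot;\xi)$ is convex and $L$-smooth for every realization of $\xi$ (with $L>0$), that $F$ is $\mu$-strongly convex with $\mu>0$, with minimizer $w_*$, and that there is $\sigma_*>0$ with $\mathbb{E}[\|\nabla f(w_*;\xi)\|^2]\le\sigma_*^2$. Let $\kappa=L/\mu$ and $\epsilon>0$. Consider iSARAH started at $\tilde w_0\in\mathbb{R}^d$ with $$\eta=\frac{2}{5L},\qquad m=20\kappa-1,\qquad b=\max\left\{20\kappa-10,\ \frac{20\sigma_*^2}{\epsilon}\right\}$$ ($m$ and $b$ rounded up to integers if necessary). Then the total work complexity to achieve $\mathbb{E}[\|\nabla F(\tilde w_s)\|^2]\le\epsilon$ is $$\mathcal{O}\left(\max\left\{\frac{\sigma_*^2}{\epsilon},\kappa\right\}\log\left(\frac1\epsilon\right)\right).$$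
   Context: $\xi$ is a random variable; for each realization, $f(\cdot;\xi):\mathbb{R}^d\to\mathbb{R}$ is differentiable; $F(w)=\mathbb{E}[f(w;\xi)]$ is bounded below, and $\mathbb{E}[\nabla f(w;\xi)]=\nabla F(w)$ for every fixed $w\in\mathbb{R}^d$. $\|\cdot\|$ is the Euclidean norm. $L$-smooth for every realization means $\|\nabla f(w;\xi)-\nabla f(w';\xi)\|\le L\|w-w'\|$ for all $w,w'\in\mathbb{R}^d$ and every realization of $\xi$. $\mu$-strong convexity of $F$ means $F(w)\ge F(w')+\nabla F(w')^T(w-w')+\frac{\mu}{2}\|w-w'\|^2$ for all $w,w'$. The procedure iSARAH-IN$(w_0,\eta,m,b)$ has parameters $\eta>0$ and positive integers $m,b$. Let $\zeta_1,\dots,\zeta_b,\xi_1,\xi_2,\dots$ be i.i.d. copies of $\xi$, independent of $w_0$. Set $$v_0=\frac1b\sum_{i=1}^b\nabla f(w_0;\zeta_i),\qquad w_1=w_0-\eta v_0,$$ and for $t\ge 1$ $$v_t=\nabla f(w_t;\xi_t)-\nabla f(w_{t-1};\xi_t)+v_{t-1},\qquad w_{t+1}=w_t-\eta v_t.$$ The output is $\tilde w=w_t$ with $t$ chosen uniformly at random from $\{0,1,\dots,m\}$, independently of everything else. iSARAH with parameters $\eta,m,b$ and a given (deterministic) starting point $\tilde w_0$ produces outer iterates $\tilde w_s=\text{iSARAH-IN}(\tilde w_{s-1},\eta,m,b)$ for $s=1,2,\dots$, using fresh independent randomness in each call. The total work complexity is the number of stochastic gradient evaluations, which up to a constant factor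 is $(b+m)s$, where $s$ is the number of outer iterations used. The claim means: for sufficiently small $\epsilon$ there is a number $s$ of outer iterations with $\mathbb{E}[\|\nabla F(\tilde w_s)\|^2]\le\epsilon$ and $(b+m)s$ bounded as stated; the constant hidden in $\mathcal{O}(\cdot)$ may depend on $\|\nabla F(\tilde w_0)\|^2$ but not on $\epsilon,\kappa,\sigma_*$. *)

theory Defs
  imports "HOL-Probability.Probability"
begin

definition grad :: "('d::real_inner \<Rightarrow> real) \<Rightarrow> 'd \<Rightarrow> 'd" where
  "grad h w = (THE D. GDERIV h w :> D)"

lemma grad_eqI: "GDERIV h w :> D \<Longrightarrow> grad h w = D"
proof -
  assume D: "GDERIV h w :> D"
  have "D' = D" if "GDERIV h w :> D'" for D'
  proof -
    have "(\<lambda>k. k \<bullet> D') = (\<lambda>k. k \<bullet> D)"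
      using D that unfolding gderiv_def by (rule has_derivative_unique[rotated])
    then show ?thesis
      by (metis inner_commute vector_eq_rdot)
  qed
  with D show ?thesis unfolding grad_def by blast
qed

text \<open>The random variable \<open>\<xi>\<close> is represented by its law \<open>M\<close>; its realizations are the points
  of \<open>space M\<close>.\<close>

abbreviation stoch_grad :: "('d::real_inner \<Rightarrow> 'a \<Rightarrow> real) \<Rightarrow> 'd \<Rightarrow> 'a \<Rightarrow> 'd" where
  "stoch_grad f w x \<equiv> grad (\<lambda>u. f u x) w"

definition expected_loss :: "'a measure \<Rightarrow> ('d \<Rightarrow> 'a \<Rightarrow> real) \<Rightarrow> 'd \<Rightarrow> real" where
  "expected_loss M f w = (\<integral>x. f w x \<partial>M)"

definition L_smooth :: "real \<Rightarrow> ('d::real_inner \<Rightarrow> real) \<Rightarrow> bool" where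
  "L_smooth L h \<longleftrightarrow> (\<forall>w w'. norm (grad h w - grad h w') \<le> L * norm (w - w'))"

definition strongly_convex :: "real \<Rightarrow> ('d::real_inner \<Rightarrow> real) \<Rightarrow> bool" where
  "strongly_convex \<mu> h \<longleftrightarrow>
     (\<forall>w w'. h w \<ge> h w' + grad h w' \<bullet> (w - w') + \<mu> / 2 * (norm (w - w'))\<^sup>2)"

locale stochastic_problem = prob_space M
  for M :: "'a measure" +
  fixes f :: "real ^ 'd \<Rightarrow> 'a \<Rightarrow> real"
    and L \<mu> \<sigma> :: real
    and wstar :: "real ^ 'd"
  assumes differentiable_f: "x \<in> space M \<Longrightarrow> (\<lambda>u. f u x) differentiable (at w)"
    and integrable_f: "integrable M (f w)"
    and bounded_below: "bdd_below (range (expected_loss M f))"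
    and differentiable_F: "expected_loss M f differentiable (at w)"
    and integrable_stoch_grad: "integrable M (stoch_grad f w)"
    and unbiased: "(\<integral>x. stoch_grad f w x \<partial>M) = grad (expected_loss M f) w"
    and L_pos: "L > 0"
    and convex_f: "x \<in> space M \<Longrightarrow> convex_on UNIV (\<lambda>u. f u x)"
    and smooth_f: "x \<in> space M \<Longrightarrow> L_smooth L (\<lambda>u. f u x)"
    and mu_pos: "\<mu> > 0"
    and strongly_convex_F: "strongly_convex \<mu> (expected_loss M f)"
    and minimizer: "expected_loss M f wstar \<le> expected_loss M f w"
    and sigma_pos: "\<sigma> > 0"
    and integrable_noise: "integrable M (\<lambda>x. (norm (stoch_grad f wstar x))\<^sup>2)"
    and noise_bound: "(\<integral>x. (norm (stoch_grad f wstar x))\<^sup>2 \<partial>M) \<le> \<sigma>\<^sup>2"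

text \<open>One call of the inner loop, for fixed samples \<open>\<zeta> 1, \<dots>, \<zeta> b\<close> and \<open>\<xi> 1, \<xi> 2, \<dots>\<close>.\<close>

fun inner_w :: "('d::real_inner \<Rightarrow> 'a \<Rightarrow> real) \<Rightarrow> real \<Rightarrow> nat \<Rightarrow> 'd \<Rightarrow>
      (nat \<Rightarrow> 'a) \<Rightarrow> (nat \<Rightarrow> 'a) \<Rightarrow> nat \<Rightarrow> 'd"
and inner_v :: "('d::real_inner \<Rightarrow> 'a \<Rightarrow> real) \<Rightarrow> real \<Rightarrow> nat \<Rightarrow> 'd \<Rightarrow>
      (nat \<Rightarrow> 'a) \<Rightarrow> (nat \<Rightarrow> 'a) \<Rightarrow> nat \<Rightarrow> 'd" where
  "inner_w f \<eta> b w0 \<zeta> \<xi> 0 = w0"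
| "inner_w f \<eta> b w0 \<zeta> \<xi> (Suc t) = inner_w f \<eta> b w0 \<zeta> \<xi> t - \<eta> *\<^sub>R inner_v f \<eta> b w0 \<zeta> \<xi> t"
| "inner_v f \<eta> b w0 \<zeta> \<xi> 0 = (1 / real b) *\<^sub>R (\<Sum>i = 1..b. stoch_grad f w0 (\<zeta> i))"
| "inner_v f \<eta> b w0 \<zeta> \<xi> (Suc t) =
     stoch_grad f (inner_w f \<eta> b w0 \<zeta> \<xi> (Suc t)) (\<xi> (Suc t))
     - stoch_grad f (inner_w f \<eta> b w0 \<zeta> \<xi> t) (\<xi> (Suc t))
     + inner_v f \<eta> b w0 \<zeta> \<xi> t"

text \<open>Outer iterates as functions of the outcome \<open>\<omega>\<close>. Call number \<open>s\<close> of the inner loop uses the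
  samples \<open>\<zeta> s\<close> and \<open>\<xi> s\<close>, and returns its iterate with index \<open>\<tau> s\<close>.\<close>

primrec iSARAH :: "('d::real_inner \<Rightarrow> 'a \<Rightarrow> real) \<Rightarrow> real \<Rightarrow> nat \<Rightarrow> 'd \<Rightarrow>
      (nat \<Rightarrow> nat \<Rightarrow> '\<omega> \<Rightarrow> 'a) \<Rightarrow> (nat \<Rightarrow> nat \<Rightarrow> '\<omega> \<Rightarrow> 'a) \<Rightarrow> (nat \<Rightarrow> '\<omega> \<Rightarrow> nat) \<Rightarrow>
      nat \<Rightarrow> '\<omega> \<Rightarrow> 'd" where
  "iSARAH f \<eta> b w0 \<zeta> \<xi> \<tau> 0 \<omega> = w0"
| "iSARAH f \<eta> b w0 \<zeta> \<xi> \<tau> (Suc s) \<omega> =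
     inner_w f \<eta> b (iSARAH f \<eta> b w0 \<zeta> \<xi> \<tau> s \<omega>)
       (\<lambda>i. \<zeta> (Suc s) i \<omega>) (\<lambda>t. \<xi> (Suc s) t \<omega>) (\<tau> (Suc s) \<omega>)"

text \<open>Joint independence is stated with \<open>indep_sets\<close> because \<open>indep_vars\<close> needs a common value type,
  while the samples and the output indices have different ones.\<close>

datatype source = Zeta nat nat | Xi nat nat | Tau nat

definition sources :: "nat \<Rightarrow> source set" where
  "sources b = {Zeta s i | s i. 1 \<le> s \<and> 1 \<le> i \<and> i \<le> b}
     \<union> {Xi s t | s t. 1 \<le> s \<and> 1 \<le> t} \<union> {Tau s | s. 1 \<le> s}"

definition events_of :: "'\<omega> measure \<Rightarrow> 'c measure \<Rightarrow> ('\<omega> \<Rightarrow> 'c) \<Rightarrow> '\<omega> set set" where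
  "events_of P N X = {X -` A \<inter> space P | A. A \<in> sets N}"

fun source_events :: "'\<omega> measure \<Rightarrow> 'a measure \<Rightarrow> (nat \<Rightarrow> nat \<Rightarrow> '\<omega> \<Rightarrow> 'a) \<Rightarrow>
      (nat \<Rightarrow> nat \<Rightarrow> '\<omega> \<Rightarrow> 'a) \<Rightarrow> (nat \<Rightarrow> '\<omega> \<Rightarrow> nat) \<Rightarrow> source \<Rightarrow> '\<omega> set set" where
  "source_events P M \<zeta> \<xi> \<tau> (Zeta s i) = events_of P M (\<zeta> s i)"
| "source_events P M \<zeta> \<xi> \<tau> (Xi s t) = events_of P M (\<xi> s t)"
| "source_events P M \<zeta> \<xi> \<tau> (Tau s) = events_of P (count_space UNIV) (\<tau> s)"

locale iSARAH_randomness = prob_space P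
  for P :: "'\<omega> measure" +
  fixes M :: "'a measure"
    and m b :: nat
    and \<zeta> \<xi> :: "nat \<Rightarrow> nat \<Rightarrow> '\<omega> \<Rightarrow> 'a"
    and \<tau> :: "nat \<Rightarrow> '\<omega> \<Rightarrow> nat"
  assumes zeta_measurable: "s \<ge> 1 \<Longrightarrow> i \<in> {1..b} \<Longrightarrow> random_variable M (\<zeta> s i)"
    and zeta_law: "s \<ge> 1 \<Longrightarrow> i \<in> {1..b} \<Longrightarrow> distr P M (\<zeta> s i) = M"
    and xi_measurable: "s \<ge> 1 \<Longrightarrow> t \<ge> 1 \<Longrightarrow> random_variable M (\<xi> s t)"
    and xi_law: "s \<ge> 1 \<Longrightarrow> t \<ge> 1 \<Longrightarrow> distr P M (\<xi> s t) = M"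
    and tau_measurable: "s \<ge> 1 \<Longrightarrow> random_variable (count_space UNIV) (\<tau> s)"
    and tau_law: "s \<ge> 1 \<Longrightarrow>
          distr P (count_space UNIV) (\<tau> s) = measure_pmf (pmf_of_set {0..m})"
    and independent: "indep_sets (source_events P M \<zeta> \<xi> \<tau>) (sources b)"

end

theory Submission
  imports Defs
begin

text \<open>
  Write \<open>W\<^sub>t\<close>, \<open>V\<^sub>t\<close> for the inner iterates and directions of one call and
  \<open>e\<^sub>t = \<nabla>F(W\<^sub>t) - V\<^sub>t\<close>. Since \<open>W\<^sub>t\<close>, \<open>W\<^sub>t\<^sub>+\<^sub>1\<close> and \<open>V\<^sub>t\<close> are determined before
  \<open>\<xi>\<^sub>t\<^sub>+\<^sub>1\<close> is drawn, the cross terms vanish and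
  \<open>E|e\<^sub>t\<^sub>+\<^sub>1|\<^sup>2 \<le> E|e\<^sub>t|\<^sup>2 + E|V\<^sub>t\<^sub>+\<^sub>1 - V\<^sub>t|\<^sup>2\<close>. Cocoercivity of the stochastic gradients gives
  \<open>4|V\<^sub>t\<^sub>+\<^sub>1 - V\<^sub>t|\<^sup>2 \<le> |V\<^sub>t|\<^sup>2 - |V\<^sub>t\<^sub>+\<^sub>1|\<^sup>2\<close> for \<open>\<eta>L = 2/5\<close>, so \<open>E|e\<^sub>t|\<^sup>2 + E|V\<^sub>t|\<^sup>2/4\<close> does not
  increase along the inner loop. Its initial value is controlled by the mini-batch variance, which
  cocoercivity and strong convexity bound by \<open>((2\<kappa> - 1) E|\<nabla>F(W\<^sub>0)|\<^sup>2 + 2\<sigma>\<^sup>2)/b\<close>. Summing the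
  descent inequality for \<open>F\<close> over the inner loop then yields
  \<open>E|\<nabla>F(w\<^sub>s\<^sub>+\<^sub>1)|\<^sup>2 \<le> (1/8 + 1/4 + 1/8) E|\<nabla>F(w\<^sub>s)|\<^sup>2 + \<epsilon>/8\<close> for the outer iterates, and
  \<open>s = \<lceil>2 log\<^sub>2 (1/\<epsilon>)\<rceil>\<close> outer steps suffice once \<open>\<epsilon>\<close> is small relative to \<open>|\<nabla>F(w\<^sub>0)|\<^sup>2\<close>.
\<close>

section \<open>Smooth convex functions\<close>

text \<open>Differentiability yields only a linear functional. Its adjoint evaluated at 1 is the
  representing vector, so the \<open>THE\<close> in \<open>grad\<close> picks out a genuine
  gradient.\<close>

lemma GDERIV_grad:
  fixes h :: "real ^ 'n \<Rightarrow> real"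
  assumes "h differentiable (at w)"
  shows "GDERIV h w :> grad h w"
proof -
  obtain h' where h': "(h has_derivative h') (at w)"
    using assms unfolding differentiable_def by blast
  then have lin: "linear h'" by (simp add: has_derivative_linear)
  have "h' = (\<lambda>k. k \<bullet> adjoint h' 1)"
    using adjoint_works[OF lin, where y=1] by (auto simp: inner_commute)
  then have "GDERIV h w :> adjoint h' 1"
    using h' unfolding gderiv_def by presburger
  then show ?thesis using grad_eqI by metis
qed

lemma GDERIV_line:
  assumes "GDERIV h (x + t *\<^sub>R d) :> D"
  shows "((\<lambda>t. h (x + t *\<^sub>R d)) has_real_derivative d \<bullet> D) (at t)"
proof -
  have "((\<lambda>t. h (x + t *\<^sub>R d)) has_derivative (\<lambda>s. (s *\<^sub>R d) \<bullet> D)) (at t)"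
    by (rule has_derivative_compose[where f="\<lambda>t. x + t *\<^sub>R d" and g=h])
       (auto intro!: derivative_eq_intros assms[unfolded gderiv_def])
  moreover have "(\<lambda>s. (s *\<^sub>R d) \<bullet> D) = (*) (d \<bullet> D)"
    by (simp add: fun_eq_iff mult.commute)
  ultimately show ?thesis
    unfolding has_field_derivative_def by (rule has_derivative_eq_rhs)
qed

locale smooth_function =
  fixes h :: "'d::real_inner \<Rightarrow> real" and L :: real
  assumes GDERIV: "GDERIV h w :> grad h w"
    and smooth: "L_smooth L h"
    and L_pos: "L > 0"
begin

lemma grad_lipschitz: "norm (grad h w - grad h w') \<le> L * norm (w - w')"
  using smooth unfolding L_smooth_def by blast

text \<open>On the segment from \<open>x\<close> to \<open>y\<close>, \<open>p\<close> is
  \<open>h\<close> minus the linear term of its tangent and minus the quadratic term. Cauchy-Schwarz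
  and the Lipschitz gradient make its derivative nonpositive on [0,1].\<close>

lemma descent:
  "h y \<le> h x + grad h x \<bullet> (y - x) + L / 2 * (norm (y - x))\<^sup>2"
proof -
  define d where "d = y - x"
  define p where "p t = h (x + t *\<^sub>R d) - t * (grad h x \<bullet> d) - L / 2 * t\<^sup>2 * (norm d)\<^sup>2" for t
  have "p 1 \<le> p 0"
  proof (rule DERIV_nonpos_imp_nonincreasing[where f=p])
    fix t :: real assume t: "0 \<le> t" "t \<le> 1"
    have "(p has_real_derivative
        d \<bullet> grad h (x + t *\<^sub>R d) - grad h x \<bullet> d - L * t * (norm d)\<^sup>2) (at t)"
      unfolding p_def by (auto intro!: derivative_eq_intros GDERIV_line[OF GDERIV])
    moreover have "d \<bullet> grad h (x + t *\<^sub>R d) - grad h x \<bullet> d - L * t * (norm d)\<^sup>2 \<le> 0"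
    proof -
      have "d \<bullet> grad h (x + t *\<^sub>R d) - grad h x \<bullet> d = d \<bullet> (grad h (x + t *\<^sub>R d) - grad h x)"
        by (simp add: inner_diff_right inner_commute)
      also have "\<dots> \<le> norm d * norm (grad h (x + t *\<^sub>R d) - grad h x)"
        by (rule norm_cauchy_schwarz)
      also have "\<dots> \<le> norm d * (L * norm (t *\<^sub>R d))"
        using grad_lipschitz[of "x + t *\<^sub>R d" x] by (intro mult_left_mono) auto
      also have "\<dots> = L * t * (norm d)\<^sup>2"
        using t by (simp add: power2_eq_square)
      finally show ?thesis by simp
    qed
    ultimately show "\<exists>y. (p has_real_derivative y) (at t) \<and> y \<le> 0" by blast
  qed simp
  then show ?thesis by (simp add: p_def d_def)
qed

text \<open>The direction \<open>k\<close> is left free because two choices are used later: a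
  difference of gradients for cocoercivity, and the gradient itself at the minimizer.\<close>

lemma gradient_step_value:
  "h (y - (1 / L) *\<^sub>R k) \<le> h y - (1 / L) * (grad h y \<bullet> k) + (norm k)\<^sup>2 / (2 * L)"
proof -
  have "L / 2 * (norm (- ((1 / L) *\<^sub>R k)))\<^sup>2 = (norm k)\<^sup>2 / (2 * L)"
    using L_pos by (simp add: power_divide power2_eq_square)
  then show ?thesis
    using descent[of "y - (1 / L) *\<^sub>R k" y] by simp
qed

end

locale convex_smooth_function = smooth_function +
  assumes convex: "convex_on UNIV h"
begin

text \<open>Convexity passes to the restriction of \<open>h\<close> to the line through
  \<open>x\<close> and \<open>z\<close>, where the one-dimensional tangent inequality
  applies.\<close>

lemma above_tangent: "h x + grad h x \<bullet> (z - x) \<le> h z"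
proof -
  define d where "d = z - x"
  have "convex_on UNIV (\<lambda>t. h (x + t *\<^sub>R d))"
  proof (rule convex_onI)
    fix t u v :: real assume t: "0 < t" "t < 1"
    have "x + ((1 - t) *\<^sub>R u + t *\<^sub>R v) *\<^sub>R d = (1 - t) *\<^sub>R (x + u *\<^sub>R d) + t *\<^sub>R (x + v *\<^sub>R d)"
      by (simp add: algebra_simps)
    then show "h (x + ((1 - t) *\<^sub>R u + t *\<^sub>R v) *\<^sub>R d)
        \<le> (1 - t) * h (x + u *\<^sub>R d) + t * h (x + v *\<^sub>R d)"
      using convex_onD[OF convex, of t "x + u *\<^sub>R d" "x + v *\<^sub>R d"] t by simp
  qed simp
  then have "(d \<bullet> grad h x) * (1 - 0) \<le> h (x + 1 *\<^sub>R d) - h (x + 0 *\<^sub>R d)"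
    by (rule convex_on_imp_above_tangent)
       (use GDERIV_line[of h x 0 d "grad h x"] GDERIV[of x] in auto)
  then show ?thesis by (simp add: d_def inner_commute)
qed

text \<open>The auxiliary point \<open>y - (1 / L) *\<^sub>R k\<close> lies above the tangent at
  \<open>x\<close> by convexity, while descent from \<open>y\<close> bounds its value from above.
  What remains is |k|^2/L - |k|^2/(2L) = |k|^2/(2L).\<close>

lemma smooth_convex_lower_bound:
  "h x + grad h x \<bullet> (y - x) + (norm (grad h y - grad h x))\<^sup>2 / (2 * L) \<le> h y"
proof -
  define k where "k = grad h y - grad h x"
  have k: "grad h y \<bullet> k - grad h x \<bullet> k = (norm k)\<^sup>2"
    unfolding k_def power2_norm_eq_inner by (simp add: inner_diff_left)
  have "h x + grad h x \<bullet> (y - (1 / L) *\<^sub>R k - x) \<le> h (y - (1 / L) *\<^sub>R k)"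
    by (rule above_tangent)
  also have "\<dots> \<le> h y - (1 / L) * (grad h y \<bullet> k) + (norm k)\<^sup>2 / (2 * L)"
    by (rule gradient_step_value)
  finally have "h x + grad h x \<bullet> (y - x) + (1 / L) * (grad h y \<bullet> k - grad h x \<bullet> k)
      - (norm k)\<^sup>2 / (2 * L) \<le> h y"
    by (simp add: algebra_simps)
  then show ?thesis unfolding k by (simp add: k_def)
qed

text \<open>The preceding lower bound is added to itself with \<open>x\<close> and \<open>y\<close>
  exchanged; the function values cancel.\<close>

lemma cocoercive:
  "(norm (grad h x - grad h y))\<^sup>2 \<le> L * ((grad h x - grad h y) \<bullet> (x - y))"
proof -
  have "(norm (grad h x - grad h y))\<^sup>2 / L \<le> (grad h x - grad h y) \<bullet> (x - y)"
    using smooth_convex_lower_bound[of x y] smooth_convex_lower_bound[of y x] L_pos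
    by (simp add: norm_minus_commute algebra_simps)
  then show ?thesis using L_pos by (simp add: field_simps)
qed

end

section \<open>The stochastic problem\<close>

text \<open>Simple functions discretize the first argument to finitely many values, where joint
  measurability is immediate; continuity carries it to the limit. This makes stochastic gradients at
  random points measurable.\<close>

lemma borel_measurable_caratheodory:
  fixes g :: "'d::{second_countable_topology,metric_space} \<Rightarrow> 'a \<Rightarrow> 'e::{second_countable_topology,metric_space}"
  assumes meas: "\<And>w. g w \<in> borel_measurable M"
    and cont: "\<And>x. x \<in> space M \<Longrightarrow> continuous_on UNIV (\<lambda>w. g w x)"
  shows "(\<lambda>p. g (fst p) (snd p)) \<in> borel_measurable (borel \<Otimes>\<^sub>M M)"
proof -
  obtain F :: "nat \<Rightarrow> 'd \<Rightarrow> 'd" where F: "\<And>i. simple_function borel (F i)" "\<And>w. (\<lambda>i. F i w) \<longlonglongrightarrow> w"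
    using borel_measurable_implies_sequence_metric[of "\<lambda>w::'d. w" borel undefined]
    by (auto simp: space_borel)
  show ?thesis
  proof (rule borel_measurable_LIMSEQ_metric)
    fix i
    have fin: "finite (range (F i))"
      using F(1)[of i] by (simp add: simple_function_def)
    have "F i \<in> borel \<rightarrow>\<^sub>M count_space (range (F i))"
      using F(1)[of i] fin by (auto simp: measurable_count_space_eq2 simple_function_def)
    then have "(\<lambda>p. F i (fst p)) \<in> borel \<Otimes>\<^sub>M M \<rightarrow>\<^sub>M count_space (range (F i))"
      by (rule measurable_compose[OF measurable_fst])
    then show "(\<lambda>p. g (F i (fst p)) (snd p)) \<in> borel_measurable (borel \<Otimes>\<^sub>M M)"
      by (rule measurable_compose_countable'[where f="\<lambda>w p. g w (snd p)", rotated])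
         (auto intro: countable_finite fin measurable_compose[OF measurable_snd meas])
  next
    fix p :: "'d \<times> 'a" assume "p \<in> space (borel \<Otimes>\<^sub>M M)"
    then have "isCont (\<lambda>w. g w (snd p)) (fst p)"
      using cont[of "snd p"] by (auto simp: space_pair_measure continuous_on_eq_continuous_at)
    then show "(\<lambda>i. g (F i (fst p)) (snd p)) \<longlonglongrightarrow> g (fst p) (snd p)"
      using F(2) by (rule isCont_tendsto_compose)
  qed
qed

context stochastic_problem
begin

abbreviation "gradF \<equiv> grad (expected_loss M f)"
abbreviation "gradf \<equiv> stoch_grad f"

lemma convex_smooth_f: "x \<in> space M \<Longrightarrow> convex_smooth_function (\<lambda>u. f u x) L"
  by unfold_locales (auto intro: GDERIV_grad differentiable_f smooth_f L_pos convex_f)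

lemma gradf_lipschitz:
  "x \<in> space M \<Longrightarrow> norm (gradf w x - gradf w' x) \<le> L * norm (w - w')"
  using smooth_function.grad_lipschitz convex_smooth_f convex_smooth_function.axioms(1) by blast

text \<open>By \<open>unbiased\<close>, the gradient difference of the mean is the mean of the
  gradient differences, so the Lipschitz constant of the realizations is inherited.\<close>

lemma gradF_lipschitz: "norm (gradF w - gradF w') \<le> L * norm (w - w')"
proof -
  have "gradF w - gradF w' = (\<integral>x. gradf w x - gradf w' x \<partial>M)"
    by (simp add: unbiased integrable_stoch_grad)
  also have "norm \<dots> \<le> (\<integral>x. norm (gradf w x - gradf w' x) \<partial>M)"
    by (rule integral_norm_bound)
  also have "\<dots> \<le> (\<integral>x. L * norm (w - w') \<partial>M)"
    by (intro integral_mono) (auto simp: integrable_stoch_grad gradf_lipschitz)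
  finally show ?thesis by (simp add: prob_space)
qed

lemma smooth_F: "smooth_function (expected_loss M f) L"
  by unfold_locales
     (auto intro: GDERIV_grad differentiable_F L_pos gradF_lipschitz simp: L_smooth_def)

text \<open>A gradient step with factor \<open>1 / L\<close> from \<open>wstar\<close> would lower
  the value by at least |g|^2/(2L), which minimality forbids unless g = 0.\<close>

lemma gradF_wstar: "gradF wstar = 0"
proof -
  let ?g = "gradF wstar"
  have "expected_loss M f wstar \<le> expected_loss M f (wstar - (1 / L) *\<^sub>R ?g)"
    by (rule minimizer)
  also have "\<dots> \<le> expected_loss M f wstar - (1 / L) * (?g \<bullet> ?g) + (norm ?g)\<^sup>2 / (2 * L)"
    by (rule smooth_function.gradient_step_value[OF smooth_F])
  finally have "?g \<bullet> ?g \<le> 0"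
    using L_pos by (simp add: power2_norm_eq_inner field_simps)
  then show ?thesis by (metis inner_gt_zero_iff not_le)
qed

lemma strongly_convexD:
  "expected_loss M f w' + gradF w' \<bullet> (w - w') + \<mu> / 2 * (norm (w - w'))\<^sup>2 \<le> expected_loss M f w"
  using strongly_convex_F unfolding strongly_convex_def by blast

text \<open>Strong convexity is added in both orders of the two points; the gradient at
  \<open>wstar\<close> vanishes.\<close>

lemma strong_monotone: "\<mu> * (norm (w - wstar))\<^sup>2 \<le> gradF w \<bullet> (w - wstar)"
proof -
  have "gradF w \<bullet> (wstar - w) = - (gradF w \<bullet> (w - wstar))"
    by (simp add: inner_diff_right)
  then show ?thesis
    using strongly_convexD[of w wstar] strongly_convexD[of wstar w]
    by (simp add: gradF_wstar norm_minus_commute)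
qed

lemma dist_minimizer_le: "\<mu> * norm (w - wstar) \<le> norm (gradF w)"
proof (cases "w = wstar")
  case False
  have "(\<mu> * norm (w - wstar)) * norm (w - wstar) \<le> norm (gradF w) * norm (w - wstar)"
    using strong_monotone[of w] norm_cauchy_schwarz[of "gradF w" "w - wstar"]
    by (simp add: power2_eq_square mult.assoc)
  then show ?thesis using False by simp
qed simp

text \<open>Cocoercivity produces this inner product with factor \<open>L\<close> in the variance
  bound; the factor \<open>1 / \<mu>\<close> here is how the condition number enters there.\<close>

lemma gradF_inner_le: "gradF w \<bullet> (w - wstar) \<le> (norm (gradF w))\<^sup>2 / \<mu>"
proof -
  have "gradF w \<bullet> (w - wstar) \<le> norm (gradF w) * norm (w - wstar)"
    by (rule norm_cauchy_schwarz)
  also have "\<dots> \<le> norm (gradF w) * (norm (gradF w) / \<mu>)"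
    using dist_minimizer_le[of w] mu_pos by (intro mult_left_mono) (auto simp: field_simps)
  finally show ?thesis by (simp add: power2_eq_square)
qed

text \<open>Completing the square in the strong convexity inequality, with \<open>wstar\<close> as
  the second point, bounds the optimality gap by the gradient.\<close>

lemma polyak_lojasiewicz:
  "expected_loss M f w - expected_loss M f wstar \<le> (norm (gradF w))\<^sup>2 / (2 * \<mu>)"
proof -
  let ?d = "wstar - w"
  have "0 \<le> (norm (\<mu> *\<^sub>R ?d + gradF w))\<^sup>2" by simp
  also have "\<dots> = \<mu>\<^sup>2 * (norm ?d)\<^sup>2 + 2 * \<mu> * (gradF w \<bullet> ?d) + (norm (gradF w))\<^sup>2"
    unfolding power2_norm_eq_inner
    by (simp add: inner_add_left inner_add_right inner_commute power2_eq_square)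
  finally have "0 \<le> (2 * \<mu>) * (\<mu> / 2 * (norm ?d)\<^sup>2 + gradF w \<bullet> ?d + (norm (gradF w))\<^sup>2 / (2 * \<mu>))"
    using mu_pos by (simp add: algebra_simps power2_eq_square)
  then have "0 \<le> \<mu> / 2 * (norm ?d)\<^sup>2 + gradF w \<bullet> ?d + (norm (gradF w))\<^sup>2 / (2 * \<mu>)"
    using mu_pos by (simp add: zero_le_mult_iff)
  then show ?thesis using strongly_convexD[of w wstar] by simp
qed

text \<open>At distance one from the minimizer the gradient norm is at least \<open>\<mu>\<close> by
  strong convexity and at most \<open>L\<close> by smoothness. Hence the condition number is at
  least 1.\<close>

lemma mu_le_L: "\<mu> \<le> L"
proof -
  obtain e :: "real ^ 'd" where e: "e \<in> Basis" using nonempty_Basis by blast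
  then have "norm e = 1" by simp
  then show ?thesis
    using dist_minimizer_le[of "wstar + e"] gradF_lipschitz[of "wstar + e" wstar]
    by (simp add: gradF_wstar)
qed

lemma gradf_measurable: "(\<lambda>p. gradf (fst p) (snd p)) \<in> borel_measurable (borel \<Otimes>\<^sub>M M)"
proof (rule borel_measurable_caratheodory)
  fix x assume "x \<in> space M"
  then have "L-lipschitz_on UNIV (\<lambda>w. gradf w x)"
    using gradf_lipschitz L_pos by (auto simp: lipschitz_on_def dist_norm)
  then show "continuous_on UNIV (\<lambda>w. gradf w x)"
    by (rule lipschitz_on_continuous_on)
qed (use integrable_stoch_grad in auto)

lemma gradF_measurable [measurable]: "gradF \<in> borel_measurable borel"
proof -
  have "L-lipschitz_on UNIV gradF"
    using gradF_lipschitz L_pos by (auto simp: lipschitz_on_def dist_norm)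
  then show ?thesis
    by (intro borel_measurable_continuous_onI lipschitz_on_continuous_on)
qed

end

section \<open>Independence of new samples from the past\<close>

lemma Int_stable_events_of: "Int_stable (events_of P N X)"
proof (rule Int_stableI)
  fix a c assume "a \<in> events_of P N X" "c \<in> events_of P N X"
  then obtain A C where "A \<in> sets N" "C \<in> sets N"
    "a = X -` A \<inter> space P" "c = X -` C \<inter> space P" unfolding events_of_def by blast
  then have "a \<inter> c = X -` (A \<inter> C) \<inter> space P" "A \<inter> C \<in> sets N" by auto
  then show "a \<inter> c \<in> events_of P N X" unfolding events_of_def by blast
qed

section \<open>Joint laws of independent pairs and square-integrable random vectors\<close>

context prob_space
begin

text \<open>Rectangles determine the joint law. The two value types may differ, as is needed for
  pairing iterates with samples or with output indices.\<close>

lemma distr_pair_indep: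
  assumes X[measurable]: "X \<in> M \<rightarrow>\<^sub>M N" and Y[measurable]: "Y \<in> M \<rightarrow>\<^sub>M K"
    and indep: "\<And>A B. A \<in> sets N \<Longrightarrow> B \<in> sets K \<Longrightarrow>
      prob ((X -` A \<inter> space M) \<inter> (Y -` B \<inter> space M)) = prob (X -` A \<inter> space M) * prob (Y -` B \<inter> space M)"
  shows "distr M (N \<Otimes>\<^sub>M K) (\<lambda>\<omega>. (X \<omega>, Y \<omega>)) = distr M N X \<Otimes>\<^sub>M distr M K Y"
proof (rule pair_measure_eqI[symmetric])
  interpret X: prob_space "distr M N X" by (rule prob_space_distr) simp
  interpret Y: prob_space "distr M K Y" by (rule prob_space_distr) simp
  show "sigma_finite_measure (distr M N X)" "sigma_finite_measure (distr M K Y)" by unfold_locales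
  show "sets (distr M N X \<Otimes>\<^sub>M distr M K Y) = sets (distr M (N \<Otimes>\<^sub>M K) (\<lambda>\<omega>. (X \<omega>, Y \<omega>)))"
    by (simp cong: sets_pair_measure_cong)
  fix A B assume "A \<in> sets (distr M N X)" "B \<in> sets (distr M K Y)"
  then have AB[measurable]: "A \<in> sets N" "B \<in> sets K" by simp_all
  have "(\<lambda>\<omega>. (X \<omega>, Y \<omega>)) -` (A \<times> B) \<inter> space M = (X -` A \<inter> space M) \<inter> (Y -` B \<inter> space M)"
    by auto
  then show "emeasure (distr M N X) A * emeasure (distr M K Y) B =
      emeasure (distr M (N \<Otimes>\<^sub>M K) (\<lambda>\<omega>. (X \<omega>, Y \<omega>))) (A \<times> B)"
    using indep[OF AB] by (simp add: emeasure_distr emeasure_eq_measure ennreal_mult)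
qed

text \<open>Measurability is part of the notion, so that the closure rules below transport it
  together with the finite second moment.\<close>

definition square_integrable :: "('a \<Rightarrow> 'e::{real_inner,second_countable_topology}) \<Rightarrow> bool" where
  "square_integrable X \<longleftrightarrow> X \<in> borel_measurable M \<and> integrable M (\<lambda>\<omega>. (norm (X \<omega>))\<^sup>2)"

lemma square_integrableD: "square_integrable X \<Longrightarrow> integrable M (\<lambda>\<omega>. (norm (X \<omega>))\<^sup>2)"
  by (simp add: square_integrable_def)

lemma square_integrable_dominated:
  assumes "square_integrable Y" and X[measurable]: "X \<in> borel_measurable M"
    and bound: "AE \<omega> in M. norm (X \<omega>) \<le> norm (Y \<omega>)"
  shows "square_integrable X"
  unfolding square_integrable_def
proof
  show "integrable M (\<lambda>\<omega>. (norm (X \<omega>))\<^sup>2)"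
  proof (rule Bochner_Integration.integrable_bound[OF square_integrableD[OF assms(1)]])
    show "AE \<omega> in M. norm ((norm (X \<omega>))\<^sup>2) \<le> norm ((norm (Y \<omega>))\<^sup>2)"
      using bound by eventually_elim (simp add: power_mono)
  qed measurable
qed fact

lemma square_integrable_const: "square_integrable (\<lambda>_. c)"
  by (simp add: square_integrable_def)

lemma square_integrable_norm: "square_integrable X \<Longrightarrow> square_integrable (\<lambda>\<omega>. norm (X \<omega>))"
  by (auto simp: square_integrable_def)

lemma square_integrable_scaleR: "square_integrable X \<Longrightarrow> square_integrable (\<lambda>\<omega>. c *\<^sub>R X \<omega>)"
  by (auto simp: square_integrable_def power_mult_distrib)

lemma square_integrable_add:
  assumes "square_integrable X" "square_integrable Y"
  shows "square_integrable (\<lambda>\<omega>. X \<omega> + Y \<omega>)"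
  unfolding square_integrable_def
proof
  have [measurable]: "X \<in> borel_measurable M" "Y \<in> borel_measurable M"
    using assms by (auto simp: square_integrable_def)
  show "(\<lambda>\<omega>. X \<omega> + Y \<omega>) \<in> borel_measurable M" by measurable
  \<comment> \<open>By the parallelogram law the slack is the square of
    \<open>norm (X \<omega> - Y \<omega>)\<close>.\<close>
  have bound: "(norm (X \<omega> + Y \<omega>))\<^sup>2 \<le> 2 * (norm (X \<omega>))\<^sup>2 + 2 * (norm (Y \<omega>))\<^sup>2" for \<omega>
    using inner_ge_zero[of "X \<omega> - Y \<omega>"]
    by (simp add: power2_norm_eq_inner inner_add_left inner_add_right inner_diff_left
        inner_diff_right inner_commute)
  have "integrable M (\<lambda>\<omega>. 2 * (norm (X \<omega>))\<^sup>2 + 2 * (norm (Y \<omega>))\<^sup>2)"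
    using assms by (auto simp: square_integrable_def)
  then show "integrable M (\<lambda>\<omega>. (norm (X \<omega> + Y \<omega>))\<^sup>2)"
    by (rule Bochner_Integration.integrable_bound) (auto intro!: AE_I2 bound)
qed

lemma square_integrable_diff:
  assumes "square_integrable X" "square_integrable Y"
  shows "square_integrable (\<lambda>\<omega>. X \<omega> - Y \<omega>)"
  using square_integrable_add[OF assms(1) square_integrable_scaleR[OF assms(2), of "-1"]] by simp

lemma square_integrable_sum:
  "(\<And>i. i \<in> I \<Longrightarrow> square_integrable (X i)) \<Longrightarrow> square_integrable (\<lambda>\<omega>. \<Sum>i\<in>I. X i \<omega>)"
  by (induction I rule: infinite_finite_induct)
     (auto intro: square_integrable_add square_integrable_const)

lemma square_integrable_inner:
  assumes "square_integrable X" "square_integrable Y"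
  shows "integrable M (\<lambda>\<omega>. X \<omega> \<bullet> Y \<omega>)"
proof -
  have "(\<lambda>\<omega>. X \<omega> \<bullet> Y \<omega>) =
      (\<lambda>\<omega>. ((norm (X \<omega> + Y \<omega>))\<^sup>2 - (norm (X \<omega>))\<^sup>2 - (norm (Y \<omega>))\<^sup>2) / 2)"
    by (simp add: fun_eq_iff power2_norm_eq_inner inner_add_left inner_add_right inner_commute)
  then show ?thesis
    using square_integrableD[OF square_integrable_add[OF assms]] assms[THEN square_integrableD]
    by simp
qed

end

section \<open>Sigma-algebras generated by sets of random sources\<close>

locale iSARAH_run =
  sp: stochastic_problem M f L \<mu> \<sigma> wstar + iSARAH_randomness P M m b \<zeta> \<xi> \<tau>
  for P :: "'\<omega> measure" and M :: "'a measure" and f :: "real ^ 'd \<Rightarrow> 'a \<Rightarrow> real"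
    and L \<mu> \<sigma> :: real and wstar :: "real ^ 'd" and m b :: nat and \<zeta> \<xi> \<tau> +
  fixes w0 :: "real ^ 'd"
  assumes b_pos: "b > 0"
begin

text \<open>Measurability with respect to this sigma-algebra expresses that a quantity is determined
  by the draws in \<open>A\<close>; it takes the place of a filtration.\<close>

definition past :: "source set \<Rightarrow> '\<omega> measure" where
  "past A = sigma (space P) (\<Union>k\<in>A. source_events P M \<zeta> \<xi> \<tau> k)"

lemma source_events_Pow: "source_events P M \<zeta> \<xi> \<tau> k \<subseteq> Pow (space P)"
  by (cases k) (auto simp: events_of_def)

lemma space_past [simp]: "space (past A) = space P"
  using source_events_Pow by (auto simp: past_def space_measure_of_conv)

lemma sets_past: "sets (past A) = sigma_sets (space P) (\<Union>k\<in>A. source_events P M \<zeta> \<xi> \<tau> k)"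
  unfolding past_def using source_events_Pow by (intro sets_measure_of) blast

lemma measurable_past_mono: "X \<in> past A \<rightarrow>\<^sub>M N \<Longrightarrow> A \<subseteq> B \<Longrightarrow> X \<in> past B \<rightarrow>\<^sub>M N"
  using sigma_sets_mono'[of "\<Union>k\<in>A. source_events P M \<zeta> \<xi> \<tau> k" "\<Union>k\<in>B. source_events P M \<zeta> \<xi> \<tau> k" "space P"]
  by (auto simp: measurable_def sets_past)

lemma measurable_past_imp_measurable:
  assumes "X \<in> past A \<rightarrow>\<^sub>M N" "A \<subseteq> sources b"
  shows "X \<in> P \<rightarrow>\<^sub>M N"
proof -
  have "(\<Union>k\<in>A. source_events P M \<zeta> \<xi> \<tau> k) \<subseteq> sets P"
    using independent assms(2) unfolding indep_sets_def by blast
  then have "sets (past A) \<subseteq> sets P"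
    unfolding sets_past by (rule sets.sigma_sets_subset)
  then show ?thesis
    using assms(1) by (auto simp: measurable_def)
qed

lemma source_measurable_past:
  assumes "source_events P M \<zeta> \<xi> \<tau> k = events_of P N X" "k \<in> A" "X \<in> P \<rightarrow>\<^sub>M N"
  shows "X \<in> past A \<rightarrow>\<^sub>M N"
proof (rule measurableI)
  fix B assume "B \<in> sets N"
  then have "X -` B \<inter> space P \<in> source_events P M \<zeta> \<xi> \<tau> k"
    unfolding assms(1) events_of_def by blast
  then show "X -` B \<inter> space (past A) \<in> sets (past A)"
    unfolding sets_past using assms(2) by auto
qed (use assms(3) in \<open>auto simp: measurable_space\<close>)

lemma Int_stable_source_events: "Int_stable (source_events P M \<zeta> \<xi> \<tau> k)"
  by (cases k) (simp_all add: Int_stable_events_of)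

text \<open>The sources are grouped into the disjoint blocks \<open>A\<close> and
  \<open>{k}\<close>. Since each family of source events is intersection stable, independence
  extends to the generated sigma-algebras.\<close>

lemma past_indep:
  assumes "A \<subseteq> sources b" "k \<in> sources b" "k \<notin> A"
  shows "indep_set (sets (past A)) (source_events P M \<zeta> \<xi> \<tau> k)"
proof -
  let ?E = "source_events P M \<zeta> \<xi> \<tau>" and ?I = "case_bool A {k}"
  have "indep_sets (\<lambda>j. sigma_sets (space P) (\<Union>i\<in>?I j. ?E i)) UNIV"
  proof (rule indep_sets_collect_sigma)
    show "indep_sets ?E (\<Union>j\<in>UNIV. ?I j)"
      by (rule indep_sets_mono_index[OF _ independent]) (use assms in \<open>auto split: bool.splits\<close>)
    show "disjoint_family_on ?I UNIV"
      using assms by (auto simp: disjoint_family_on_def split: bool.splits)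
  qed (rule Int_stable_source_events)
  then show ?thesis
    unfolding indep_set_def
    by (rule indep_sets_mono_sets) (auto simp: sets_past split: bool.splits)
qed

lemma indep_distr_pair:
  assumes A: "A \<subseteq> sources b" "k \<in> sources b" "k \<notin> A"
    and Z: "source_events P M \<zeta> \<xi> \<tau> k = events_of P K Z" "Z \<in> P \<rightarrow>\<^sub>M K"
    and X: "X \<in> past A \<rightarrow>\<^sub>M N"
  shows "distr P (N \<Otimes>\<^sub>M K) (\<lambda>\<omega>. (X \<omega>, Z \<omega>)) = distr P N X \<Otimes>\<^sub>M distr P K Z"
proof (rule distr_pair_indep)
  show "X \<in> P \<rightarrow>\<^sub>M N" using X A(1) by (rule measurable_past_imp_measurable)
  fix B C assume "B \<in> sets N" "C \<in> sets K"
  then have "X -` B \<inter> space P \<in> sets (past A)" "Z -` C \<inter> space P \<in> source_events P M \<zeta> \<xi> \<tau> k"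
    using measurable_sets[OF X] unfolding Z(1) events_of_def by auto
  then show "prob ((X -` B \<inter> space P) \<inter> (Z -` C \<inter> space P))
      = prob (X -` B \<inter> space P) * prob (Z -` C \<inter> space P)"
    using past_indep[OF A] unfolding indep_sets2_eq by blast
qed fact

text \<open>Fubini on the product law: \<open>Z\<close> is integrated out while \<open>X\<close>
  stays frozen. This does the work of conditioning on the past.\<close>

lemma expectation_indep_pair:
  fixes h :: "_ \<Rightarrow> real"
  assumes A: "A \<subseteq> sources b" "k \<in> sources b" "k \<notin> A"
    and Z: "source_events P M \<zeta> \<xi> \<tau> k = events_of P K Z" "Z \<in> P \<rightarrow>\<^sub>M K"
    and X: "X \<in> past A \<rightarrow>\<^sub>M N"
    and h [measurable]: "h \<in> borel_measurable (N \<Otimes>\<^sub>M K)"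
    and int: "integrable P (\<lambda>\<omega>. h (X \<omega>, Z \<omega>))"
  shows "expectation (\<lambda>\<omega>. h (X \<omega>, Z \<omega>)) = expectation (\<lambda>\<omega>. \<integral>z. h (X \<omega>, z) \<partial>distr P K Z)"
    (is "_ = expectation (\<lambda>\<omega>. ?g (X \<omega>))")
proof -
  note [measurable] = Z(2) measurable_past_imp_measurable[OF X A(1)]
  interpret X: prob_space "distr P N X" by (rule prob_space_distr) simp
  interpret Z: prob_space "distr P K Z" by (rule prob_space_distr) simp
  interpret pair_sigma_finite "distr P N X" "distr P K Z" ..
  note eq = indep_distr_pair[OF A Z X]
  have h': "h \<in> borel_measurable (distr P N X \<Otimes>\<^sub>M distr P K Z)"
    by (simp add: measurable_cong_sets[OF sets_pair_measure_cong[OF sets_distr sets_distr] refl])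
  have "integrable (distr P (N \<Otimes>\<^sub>M K) (\<lambda>\<omega>. (X \<omega>, Z \<omega>))) h"
    using int by (subst integrable_distr_eq) auto
  then have "integrable (distr P N X \<Otimes>\<^sub>M distr P K Z) h"
    unfolding eq .
  then have "(\<integral>x. ?g x \<partial>distr P N X) = integral\<^sup>L (distr P N X \<Otimes>\<^sub>M distr P K Z) h"
    by (rule integral_fst')
  also have "\<dots> = expectation (\<lambda>\<omega>. h (X \<omega>, Z \<omega>))"
    unfolding eq[symmetric] by (subst integral_distr) auto
  finally have *: "expectation (\<lambda>\<omega>. h (X \<omega>, Z \<omega>)) = (\<integral>x. ?g x \<partial>distr P N X)" ..
  have "?g \<in> borel_measurable (distr P N X)"
    using Z.borel_measurable_lebesgue_integral[of "\<lambda>x z. h (x, z)" "distr P N X"] h' by simp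
  then have "?g \<in> borel_measurable N" by simp
  then show ?thesis
    unfolding * by (intro integral_distr) auto
qed

section \<open>Stochastic gradients at a fresh sample, and averaging over the output index\<close>

definition sample :: "source \<Rightarrow> ('\<omega> \<Rightarrow> 'a) \<Rightarrow> bool" where
  "sample k Z \<longleftrightarrow> k \<in> sources b \<and> source_events P M \<zeta> \<xi> \<tau> k = events_of P M Z
     \<and> Z \<in> P \<rightarrow>\<^sub>M M \<and> distr P M Z = M"

lemma sample_zeta: "s \<ge> 1 \<Longrightarrow> i \<in> {1..b} \<Longrightarrow> sample (Zeta s i) (\<zeta> s i)"
  using zeta_measurable zeta_law by (auto simp: sample_def sources_def)

lemma sample_xi: "s \<ge> 1 \<Longrightarrow> t \<ge> 1 \<Longrightarrow> sample (Xi s t) (\<xi> s t)"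
  using xi_measurable xi_law by (auto simp: sample_def sources_def)

lemma sample_space: "sample k Z \<Longrightarrow> \<omega> \<in> space P \<Longrightarrow> Z \<omega> \<in> space M"
  by (auto simp: sample_def measurable_def)

lemma gradf_measurable_sample:
  assumes "X \<in> borel_measurable N" "Z \<in> N \<rightarrow>\<^sub>M M"
  shows "(\<lambda>\<omega>. sp.gradf (X \<omega>) (Z \<omega>)) \<in> borel_measurable N"
  using measurable_compose[OF measurable_Pair[OF assms] sp.gradf_measurable] by simp

lemma gradf_measurable_past:
  assumes "sample k Z" "k \<in> A" "X \<in> borel_measurable (past A)"
  shows "(\<lambda>\<omega>. sp.gradf (X \<omega>) (Z \<omega>)) \<in> borel_measurable (past A)"
proof (rule gradf_measurable_sample)
  show "Z \<in> past A \<rightarrow>\<^sub>M M"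
    by (rule source_measurable_past[OF _ assms(2)]) (use assms(1) in \<open>auto simp: sample_def\<close>)
qed fact

lemma sample_noise:
  assumes "sample k Z"
  shows "square_integrable (\<lambda>\<omega>. sp.gradf wstar (Z \<omega>))"
    and "expectation (\<lambda>\<omega>. (norm (sp.gradf wstar (Z \<omega>)))\<^sup>2) \<le> \<sigma>\<^sup>2"
proof -
  have Z [measurable]: "Z \<in> P \<rightarrow>\<^sub>M M" and law: "distr P M Z = M"
    using assms by (auto simp: sample_def)
  note [measurable] = sp.integrable_stoch_grad[of wstar, THEN borel_measurable_integrable]
  have "integrable P (\<lambda>\<omega>. (norm (sp.gradf wstar (Z \<omega>)))\<^sup>2)"
    using sp.integrable_noise integrable_distr_eq[of Z P M "\<lambda>x. (norm (sp.gradf wstar x))\<^sup>2"] law by auto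
  then show "square_integrable (\<lambda>\<omega>. sp.gradf wstar (Z \<omega>))"
    by (simp add: square_integrable_def)
  show "expectation (\<lambda>\<omega>. (norm (sp.gradf wstar (Z \<omega>)))\<^sup>2) \<le> \<sigma>\<^sup>2"
    using sp.noise_bound integral_distr[of Z P M "\<lambda>x. (norm (sp.gradf wstar x))\<^sup>2"] law by auto
qed

text \<open>Second moments of the noise are given only at \<open>wstar\<close>; the Lipschitz bound
  transports them to the random point \<open>X\<close>.\<close>

lemma square_integrable_gradf:
  assumes Z: "sample k Z" and X: "square_integrable X"
  shows "square_integrable (\<lambda>\<omega>. sp.gradf (X \<omega>) (Z \<omega>))"
proof (rule square_integrable_dominated)
  show "square_integrable (\<lambda>\<omega>. norm (sp.gradf wstar (Z \<omega>)) + L *\<^sub>R norm (X \<omega> - wstar))"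
    using sample_noise(1)[OF Z] X
    by (intro square_integrable_add square_integrable_scaleR square_integrable_norm
        square_integrable_diff square_integrable_const)
  show "(\<lambda>\<omega>. sp.gradf (X \<omega>) (Z \<omega>)) \<in> borel_measurable P"
    using X Z by (intro gradf_measurable_sample) (auto simp: sample_def square_integrable_def)
  have "norm (sp.gradf (X \<omega>) (Z \<omega>)) \<le> norm (sp.gradf wstar (Z \<omega>)) + L * norm (X \<omega> - wstar)"
    if "\<omega> \<in> space P" for \<omega>
    using sp.gradf_lipschitz[OF sample_space[OF Z that], of "X \<omega>" wstar]
      norm_triangle_sub[of "sp.gradf (X \<omega>) (Z \<omega>)" "sp.gradf wstar (Z \<omega>)"] by linarith
  then show "AE \<omega> in P. norm (sp.gradf (X \<omega>) (Z \<omega>))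
      \<le> norm (norm (sp.gradf wstar (Z \<omega>)) + L *\<^sub>R norm (X \<omega> - wstar))"
    using sp.L_pos by (intro AE_I2) force
qed

lemma square_integrable_gradF:
  assumes X: "square_integrable X"
  shows "square_integrable (\<lambda>\<omega>. sp.gradF (X \<omega>))"
proof (rule square_integrable_dominated)
  show "square_integrable (\<lambda>\<omega>. L *\<^sub>R (X \<omega> - wstar))"
    using X by (intro square_integrable_scaleR square_integrable_diff square_integrable_const)
  show "(\<lambda>\<omega>. sp.gradF (X \<omega>)) \<in> borel_measurable P"
    using X by (auto simp: square_integrable_def)
  show "AE \<omega> in P. norm (sp.gradF (X \<omega>)) \<le> norm (L *\<^sub>R (X \<omega> - wstar))"
    using sp.gradF_lipschitz[of _ wstar] sp.L_pos by (intro AE_I2) (auto simp: sp.gradF_wstar)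
qed

text \<open>With \<open>U\<close> and \<open>X\<close> determined by the past and \<open>Z\<close>
  fresh, averaging over \<open>Z\<close> replaces the stochastic gradient by the full one. All cross
  terms below are evaluated through this identity.\<close>

lemma expectation_inner_gradf:
  assumes Z: "sample k Z" and A: "A \<subseteq> sources b" "k \<notin> A"
    and U: "U \<in> borel_measurable (past A)" "square_integrable U"
    and X: "X \<in> borel_measurable (past A)" "square_integrable X"
  shows "expectation (\<lambda>\<omega>. U \<omega> \<bullet> sp.gradf (X \<omega>) (Z \<omega>)) = expectation (\<lambda>\<omega>. U \<omega> \<bullet> sp.gradF (X \<omega>))"
proof -
  define h where "h = (\<lambda>p. fst (fst p) \<bullet> sp.gradf (snd (fst p)) (snd p))"
  have Z': "k \<in> sources b" "source_events P M \<zeta> \<xi> \<tau> k = events_of P M Z" "Z \<in> P \<rightarrow>\<^sub>M M"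
    "distr P M Z = M" using Z by (auto simp: sample_def)
  have [measurable]: "(\<lambda>p. sp.gradf (snd (fst p)) (snd p)) \<in> borel_measurable ((borel \<Otimes>\<^sub>M borel) \<Otimes>\<^sub>M M)"
    by (rule gradf_measurable_sample) auto
  have h: "h \<in> borel_measurable ((borel \<Otimes>\<^sub>M borel) \<Otimes>\<^sub>M M)"
    unfolding h_def by measurable
  have int: "integrable P (\<lambda>\<omega>. h ((U \<omega>, X \<omega>), Z \<omega>))"
    using square_integrable_inner[OF U(2) square_integrable_gradf[OF Z X(2)]] by (simp add: h_def)
  have "expectation (\<lambda>\<omega>. h ((U \<omega>, X \<omega>), Z \<omega>)) =
      expectation (\<lambda>\<omega>. \<integral>z. h ((U \<omega>, X \<omega>), z) \<partial>M)"
    using expectation_indep_pair[OF A(1) Z'(1) A(2) Z'(2,3) measurable_Pair[OF U(1) X(1)] h int] Z'(4)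
    by simp
  moreover have "(\<integral>z. u \<bullet> sp.gradf x z \<partial>M) = u \<bullet> sp.gradF x" for u x
    using sp.integrable_stoch_grad sp.unbiased by (subst integral_inner_right) auto
  ultimately show ?thesis by (simp add: h_def)
qed

lemma tau_AE_le:
  assumes "s \<ge> 1"
  shows "AE \<omega> in P. \<tau> s \<omega> \<le> m"
proof -
  have "AE t in distr P (count_space UNIV) (\<tau> s). t \<le> m"
    unfolding tau_law[OF assms] by (simp add: AE_measure_pmf_iff)
  then show ?thesis
    using tau_measurable[OF assms] by (simp add: AE_distr_iff)
qed

text \<open>The expectation is split according to the value of \<open>\<tau> s\<close>. The event
  that it equals \<open>t\<close> is independent of \<open>H t\<close> and has probability
  \<open>1 / (real m + 1)\<close> for \<open>t \<le> m\<close>; larger values occur with probability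
  zero.\<close>

lemma expectation_tau:
  fixes H :: "nat \<Rightarrow> '\<omega> \<Rightarrow> real"
  assumes s: "s \<ge> 1" and A: "A \<subseteq> sources b" "Tau s \<notin> A"
    and H: "\<And>t. H t \<in> borel_measurable (past A)" "\<And>t. integrable P (H t)"
  shows "integrable P (\<lambda>\<omega>. H (\<tau> s \<omega>) \<omega>)"
    and "expectation (\<lambda>\<omega>. H (\<tau> s \<omega>) \<omega>) = (\<Sum>t\<le>m. expectation (H t)) / (real m + 1)"
proof -
  note \<tau> [measurable] = tau_measurable[OF s]
  note [measurable] = H(2)[THEN borel_measurable_integrable]
  let ?I = "\<lambda>t \<omega>. H t \<omega> * indicator {t} (\<tau> s \<omega>)"
  have [measurable]: "?I t \<in> borel_measurable P" for t
    using measurable_compose[OF \<tau>, of "indicator {t}" borel] by (intro borel_measurable_times) auto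
  have int: "integrable P (?I t)" for t
    by (rule Bochner_Integration.integrable_bound[OF H(2)[of t]])
       (auto intro!: AE_I2 split: split_indicator)
  have "measure (distr P (count_space UNIV) (\<tau> s)) {t} = 1 / (real m + 1)" if "t \<le> m" for t
    using that unfolding tau_law[OF s] by (simp add: measure_pmf_single)
  moreover have "expectation (?I t) =
    expectation (\<lambda>\<omega>. \<integral>z. H t \<omega> * indicator {t} z \<partial>distr P (count_space UNIV) (\<tau> s))" for t
  proof -
    have 1: "(\<lambda>p. fst p * indicator {t} (snd p) :: real) \<in> borel_measurable (borel \<Otimes>\<^sub>M count_space UNIV)" for t :: nat
    proof (intro borel_measurable_times)
      show "(\<lambda>p. indicator {t} (snd p) :: real) \<in> borel_measurable (borel \<Otimes>\<^sub>M count_space UNIV)"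
        by (rule measurable_compose[OF measurable_snd]) simp
    qed simp
    show ?thesis
      using expectation_indep_pair[where k="Tau s" and X="H t" and Z="\<tau> s" and K="count_space UNIV"
        and N=borel and h="\<lambda>p. fst p * indicator {t} (snd p)"] A s H(1) 1 int[of t]
      by (auto simp: sources_def)
  qed
  ultimately have E: "expectation (?I t) = expectation (H t) / (real m + 1)" if "t \<le> m" for t
    using that by simp
  have ae: "AE \<omega> in P. H (\<tau> s \<omega>) \<omega> = (\<Sum>t\<le>m. ?I t \<omega>)"
    using tau_AE_le[OF s]
  proof eventually_elim
    case (elim \<omega>)
    have "(\<Sum>t\<le>m. ?I t \<omega>) = (\<Sum>t\<le>m. if t = \<tau> s \<omega> then H t \<omega> else 0)"
      by (intro sum.cong) (auto split: split_indicator)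
    then show ?case using elim by simp
  qed
  have meas: "(\<lambda>\<omega>. H (\<tau> s \<omega>) \<omega>) \<in> borel_measurable P"
    by (rule measurable_compose_countable[where g="\<tau> s"]) auto
  have sum_int: "integrable P (\<lambda>\<omega>. \<Sum>t\<le>m. ?I t \<omega>)"
    by (intro Bochner_Integration.integrable_sum int)
  then show "integrable P (\<lambda>\<omega>. H (\<tau> s \<omega>) \<omega>)"
    using integrable_cong_AE[OF meas borel_measurable_integrable[OF sum_int] ae] by blast
  have "expectation (\<lambda>\<omega>. H (\<tau> s \<omega>) \<omega>) = expectation (\<lambda>\<omega>. \<Sum>t\<le>m. ?I t \<omega>)"
    by (rule integral_cong_AE[OF meas borel_measurable_integrable[OF sum_int] ae])
  also have "\<dots> = (\<Sum>t\<le>m. expectation (?I t))"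
    by (intro Bochner_Integration.integral_sum int)
  also have "\<dots> = (\<Sum>t\<le>m. expectation (H t)) / (real m + 1)"
    unfolding sum_divide_distrib by (intro sum.cong refl E) auto
  finally show "expectation (\<lambda>\<omega>. H (\<tau> s \<omega>) \<omega>) = (\<Sum>t\<le>m. expectation (H t)) / (real m + 1)" .
qed

end

section \<open>The inner loop\<close>

fun epoch :: "source \<Rightarrow> nat" where
  "epoch (Zeta s i) = s"
| "epoch (Xi s t) = s"
| "epoch (Tau s) = s"

definition history :: "nat \<Rightarrow> nat \<Rightarrow> source set" where
  "history b s = {k \<in> sources b. epoch k \<le> s}"

text \<open>Within call \<open>Suc s\<close> the mini-batch is revealed first, then the inner
  samples one by one (\<open>history_xi\<close>); the output index of that call appears only in
  \<open>history b (Suc s)\<close>.\<close>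

definition history_zeta :: "nat \<Rightarrow> nat \<Rightarrow> nat \<Rightarrow> source set" where
  "history_zeta b s i = history b s \<union> Zeta (Suc s) ` {1..i}"

definition history_xi :: "nat \<Rightarrow> nat \<Rightarrow> nat \<Rightarrow> source set" where
  "history_xi b s t = history_zeta b s b \<union> Xi (Suc s) ` {1..t}"

lemmas history_defs = history_def history_zeta_def history_xi_def sources_def

lemma history_subset:
  "history b s \<subseteq> sources b" "i \<le> b \<Longrightarrow> history_zeta b s i \<subseteq> sources b" "history_xi b s t \<subseteq> sources b"
  by (auto simp: history_defs)

lemma history_xi_mono: "t \<le> t' \<Longrightarrow> history_xi b s t \<subseteq> history_xi b s t'"
  by (auto simp: history_defs)

lemma history_xi_subset_history_Suc: "history_xi b s t \<subseteq> history b (Suc s)"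
  by (auto simp: history_defs)

lemma history_fresh:
  "Zeta (Suc s) (Suc i) \<notin> history_zeta b s i" "Xi (Suc s) (Suc t) \<notin> history_xi b s t"
  "Tau (Suc s) \<notin> history_xi b s t"
  by (auto simp: history_defs)

lemma sum_upto_Suc_eq: "(\<Sum>i = 1..Suc k. g i) = (\<Sum>i = 1..k. g i) + (g (Suc k) :: 'b::comm_monoid_add)"
  by (simp add: add.commute)

locale iSARAH_steps = iSARAH_run P M f L \<mu> \<sigma> wstar m b \<zeta> \<xi> \<tau> w0
  for P :: "'\<omega> measure" and M :: "'a measure" and f :: "real ^ 'd \<Rightarrow> 'a \<Rightarrow> real"
    and L \<mu> \<sigma> wstar m b \<zeta> \<xi> \<tau> w0 +
  fixes \<eta> :: real
  assumes eta: "\<eta> = 2 / (5 * L)"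
begin

section \<open>Measurability and square integrability of the iterates\<close>

abbreviation outer :: "nat \<Rightarrow> '\<omega> \<Rightarrow> real ^ 'd" where
  "outer \<equiv> iSARAH f \<eta> b w0 \<zeta> \<xi> \<tau>"

text \<open>The index \<open>s\<close> names the starting point \<open>outer s\<close>, so
  \<open>W s\<close> and \<open>V s\<close> belong to call number \<open>Suc s\<close> and consume
  its samples.\<close>

definition W :: "nat \<Rightarrow> nat \<Rightarrow> '\<omega> \<Rightarrow> real ^ 'd" where
  "W s t \<omega> = inner_w f \<eta> b (outer s \<omega>) (\<lambda>i. \<zeta> (Suc s) i \<omega>) (\<lambda>i. \<xi> (Suc s) i \<omega>) t"

definition V :: "nat \<Rightarrow> nat \<Rightarrow> '\<omega> \<Rightarrow> real ^ 'd" where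
  "V s t \<omega> = inner_v f \<eta> b (outer s \<omega>) (\<lambda>i. \<zeta> (Suc s) i \<omega>) (\<lambda>i. \<xi> (Suc s) i \<omega>) t"

lemma W_0: "W s 0 = outer s" by (simp add: W_def fun_eq_iff)
lemma W_Suc: "W s (Suc t) = (\<lambda>\<omega>. W s t \<omega> - \<eta> *\<^sub>R V s t \<omega>)" by (simp add: W_def V_def fun_eq_iff)
lemma V_0: "V s 0 = (\<lambda>\<omega>. (1 / real b) *\<^sub>R (\<Sum>i = 1..b. sp.gradf (outer s \<omega>) (\<zeta> (Suc s) i \<omega>)))"
  by (simp add: V_def fun_eq_iff)
lemma V_Suc: "V s (Suc t) = (\<lambda>\<omega>. sp.gradf (W s (Suc t) \<omega>) (\<xi> (Suc s) (Suc t) \<omega>)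
    - sp.gradf (W s t \<omega>) (\<xi> (Suc s) (Suc t) \<omega>) + V s t \<omega>)"
  by (simp add: V_def W_def fun_eq_iff)
lemma outer_Suc: "outer (Suc s) = (\<lambda>\<omega>. W s (\<tau> (Suc s) \<omega>) \<omega>)"
  by (simp add: W_def fun_eq_iff)

text \<open>The starting point enters as a hypothesis, so that the induction over outer calls can
  apply this to its own induction hypothesis.\<close>

lemma inner_measurable_past:
  assumes outer: "outer s \<in> borel_measurable (past (history b s))"
  shows "W s t \<in> borel_measurable (past (history_xi b s t))
    \<and> V s t \<in> borel_measurable (past (history_xi b s t))"
proof (induction t)
  case 0
  have outer': "outer s \<in> borel_measurable (past (history_xi b s 0))"
    by (rule measurable_past_mono[OF outer]) (auto simp: history_xi_def history_zeta_def)
  have "(\<lambda>\<omega>. sp.gradf (outer s \<omega>) (\<zeta> (Suc s) i \<omega>)) \<in> borel_measurable (past (history_xi b s 0))"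
    if "i \<in> {1..b}" for i
    by (rule gradf_measurable_past[OF sample_zeta[of "Suc s" i] _ outer'])
       (use that in \<open>auto simp: history_xi_def history_zeta_def\<close>)
  then have "V s 0 \<in> borel_measurable (past (history_xi b s 0))"
    unfolding V_0 by (intro borel_measurable_scaleR borel_measurable_sum) auto
  then show ?case using outer' by (simp add: W_0)
next
  case (Suc t)
  let ?A = "history_xi b s (Suc t)"
  have mono: "X \<in> borel_measurable (past (history_xi b s t)) \<Longrightarrow> X \<in> borel_measurable (past ?A)"
    for X :: "'\<omega> \<Rightarrow> real ^ 'd"
    by (erule measurable_past_mono) (simp add: history_xi_mono)
  have W: "W s t \<in> borel_measurable (past ?A)" and V: "V s t \<in> borel_measurable (past ?A)"
    using Suc mono by blast+
  then have W': "W s (Suc t) \<in> borel_measurable (past ?A)"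
    unfolding W_Suc by (intro borel_measurable_diff borel_measurable_scaleR) auto
  have "(\<lambda>\<omega>. sp.gradf (X \<omega>) (\<xi> (Suc s) (Suc t) \<omega>)) \<in> borel_measurable (past ?A)"
    if "X \<in> borel_measurable (past ?A)" for X
    by (rule gradf_measurable_past[OF sample_xi[of "Suc s" "Suc t"] _ that])
       (auto simp: history_xi_def)
  then have "V s (Suc t) \<in> borel_measurable (past ?A)"
    unfolding V_Suc using W W' V
    by (intro borel_measurable_diff borel_measurable_add) auto
  then show ?case using W' by blast
qed

lemma outer_measurable_past: "outer s \<in> borel_measurable (past (history b s))"
proof (induction s)
  case 0
  have "outer 0 = (\<lambda>_. w0)" by (simp add: fun_eq_iff)
  then show ?case by simp
next
  case (Suc s)
  have "W s t \<in> borel_measurable (past (history b (Suc s)))" for t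
    using inner_measurable_past[OF Suc] history_xi_subset_history_Suc
    by (blast intro: measurable_past_mono)
  moreover have "\<tau> (Suc s) \<in> past (history b (Suc s)) \<rightarrow>\<^sub>M count_space UNIV"
    by (rule source_measurable_past[where k="Tau (Suc s)"])
       (auto simp: history_def sources_def tau_measurable)
  ultimately show ?case
    unfolding outer_Suc by (rule measurable_compose_countable)
qed

lemmas W_past = inner_measurable_past[OF outer_measurable_past, THEN conjunct1]
lemmas V_past = inner_measurable_past[OF outer_measurable_past, THEN conjunct2]

text \<open>The iterate with index \<open>Suc t\<close> is computed from \<open>W s t\<close> and
  \<open>V s t\<close> alone, hence is known before the sample with index \<open>Suc t\<close> is
  drawn. This one-step lead makes the cross terms in the error recursion vanish.\<close>

lemma W_Suc_past: "W s (Suc t) \<in> borel_measurable (past (history_xi b s t))"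
  unfolding W_Suc using W_past V_past by (intro borel_measurable_diff borel_measurable_scaleR) auto

lemma sample_xi': "sample (Xi (Suc s) (Suc t)) (\<xi> (Suc s) (Suc t))"
  by (rule sample_xi) auto

lemma inner_square_integrable:
  assumes "square_integrable (outer s)"
  shows "square_integrable (W s t) \<and> square_integrable (V s t)"
proof (induction t)
  case 0
  have "square_integrable (V s 0)"
    unfolding V_0 using assms sample_zeta
    by (intro square_integrable_scaleR square_integrable_sum square_integrable_gradf) auto
  then show ?case using assms by (simp add: W_0)
next
  case (Suc t)
  then have W: "square_integrable (W s (Suc t))"
    unfolding W_Suc by (intro square_integrable_diff square_integrable_scaleR) auto
  with Suc have "square_integrable (V s (Suc t))"
    unfolding V_Suc
    by (intro square_integrable_diff square_integrable_add square_integrable_gradf[OF sample_xi']) auto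
  with W show ?case by blast
qed

text \<open>The selected iterate is almost surely one of \<open>m + 1\<close> candidates, so the sum
  of their norms dominates it.\<close>

lemma outer_square_integrable: "square_integrable (outer s)"
proof (induction s)
  case 0
  have "outer 0 = (\<lambda>_. w0)" by (simp add: fun_eq_iff)
  then show ?case by (simp add: square_integrable_const)
next
  case (Suc s)
  have W: "square_integrable (W s t)" for t using inner_square_integrable[OF Suc] by blast
  show ?case
  proof (rule square_integrable_dominated)
    show "square_integrable (\<lambda>\<omega>. \<Sum>t\<le>m. norm (W s t \<omega>))"
      by (intro square_integrable_sum square_integrable_norm W)
    show "outer (Suc s) \<in> borel_measurable P"
      using outer_measurable_past history_subset(1) by (rule measurable_past_imp_measurable)
    show "AE \<omega> in P. norm (outer (Suc s) \<omega>) \<le> norm (\<Sum>t\<le>m. norm (W s t \<omega>))"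
      using tau_AE_le[of "Suc s", simplified]
    proof eventually_elim
      case (elim \<omega>)
      then have "norm (W s (\<tau> (Suc s) \<omega>) \<omega>) \<le> (\<Sum>t\<le>m. norm (W s t \<omega>))"
        by (intro member_le_sum) auto
      then show ?case unfolding outer_Suc by simp
    qed
  qed
qed

lemmas W_sq = inner_square_integrable[OF outer_square_integrable, THEN conjunct1]
lemmas V_sq = inner_square_integrable[OF outer_square_integrable, THEN conjunct2]

lemma gradF_past: "X \<in> borel_measurable N \<Longrightarrow> (\<lambda>\<omega>. sp.gradF (X \<omega>)) \<in> borel_measurable N"
  by (rule measurable_compose[OF _ sp.gradF_measurable])

text \<open>Let \<open>D\<close> and \<open>\<delta>\<close> be the increments of the full and the
  stochastic gradient. The old error is \<open>U - D\<close> and the new one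
  \<open>U - \<delta>\<close>, with \<open>U\<close> known before the sample is drawn, so both
  increments have the same mean inner product with \<open>U\<close>.\<close>

lemma error_step:
  "expectation (\<lambda>\<omega>. (norm (sp.gradF (W s (Suc t) \<omega>) - V s (Suc t) \<omega>))\<^sup>2)
    \<le> expectation (\<lambda>\<omega>. (norm (sp.gradF (W s t \<omega>) - V s t \<omega>))\<^sup>2)
      + expectation (\<lambda>\<omega>. (norm (V s (Suc t) \<omega> - V s t \<omega>))\<^sup>2)" (is "?l \<le> ?e + ?d")
proof -
  let ?A = "history_xi b s t" and ?k = "Xi (Suc s) (Suc t)" and ?Z = "\<xi> (Suc s) (Suc t)"
  define U where "U \<omega> = sp.gradF (W s (Suc t) \<omega>) - V s t \<omega>" for \<omega>
  define I where "I Y \<omega> = U \<omega> \<bullet> Y \<omega>" for Y \<omega>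
  define g where "g = (\<lambda>\<omega>. sp.gradF (W s t \<omega>))"
  define g' where "g' = (\<lambda>\<omega>. sp.gradF (W s (Suc t) \<omega>))"
  define h where "h = (\<lambda>\<omega>. sp.gradf (W s t \<omega>) (?Z \<omega>))"
  define h' where "h' = (\<lambda>\<omega>. sp.gradf (W s (Suc t) \<omega>) (?Z \<omega>))"
  have U: "U \<in> borel_measurable (past ?A)" "square_integrable U"
    unfolding U_def using W_Suc_past V_past W_sq V_sq
    by (auto intro!: borel_measurable_diff gradF_past square_integrable_diff square_integrable_gradF)
  have sq: "square_integrable g" "square_integrable g'" "square_integrable h" "square_integrable h'"
    unfolding g_def g'_def h_def h'_def
    by (auto intro!: square_integrable_gradF square_integrable_gradf[OF sample_xi'] W_sq)
  then have I: "integrable P (I g)" "integrable P (I g')" "integrable P (I h)" "integrable P (I h')"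
    unfolding I_def by (auto intro!: square_integrable_inner U)
  have E: "expectation (I h) = expectation (I g)" "expectation (I h') = expectation (I g')"
    unfolding I_def g_def g'_def h_def h'_def
    by (rule expectation_inner_gradf[OF sample_xi' history_subset(3) history_fresh(2) U];
        rule W_past W_Suc_past W_sq)+
  have e: "integrable P (\<lambda>\<omega>. (norm (sp.gradF (W s t \<omega>) - V s t \<omega>))\<^sup>2)" for t
    by (intro square_integrableD square_integrable_diff square_integrable_gradF W_sq V_sq)
  have d: "integrable P (\<lambda>\<omega>. (norm (V s (Suc t) \<omega> - V s t \<omega>))\<^sup>2)"
    by (intro square_integrableD square_integrable_diff V_sq)
  \<comment> \<open>After expanding both squares, the inequality loses only the square of
    \<open>norm D\<close>; the last bracket has expectation zero.\<close>
  have pointwise: "(norm (sp.gradF (W s (Suc t) \<omega>) - V s (Suc t) \<omega>))\<^sup>2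
      \<le> (norm (sp.gradF (W s t \<omega>) - V s t \<omega>))\<^sup>2 + (norm (V s (Suc t) \<omega> - V s t \<omega>))\<^sup>2
        + 2 * ((I g' \<omega> - I g \<omega>) - (I h' \<omega> - I h \<omega>))" for \<omega>
  proof -
    define D where "D = g' \<omega> - g \<omega>"
    define \<delta> where "\<delta> = h' \<omega> - h \<omega>"
    have \<delta>: "V s (Suc t) \<omega> - V s t \<omega> = \<delta>"
      by (simp add: V_Suc \<delta>_def h_def h'_def)
    have 1: "sp.gradF (W s (Suc t) \<omega>) - V s (Suc t) \<omega> = U \<omega> - \<delta>"
      unfolding \<delta>[symmetric] U_def by simp
    have 2: "sp.gradF (W s t \<omega>) - V s t \<omega> = U \<omega> - D"
      by (simp add: U_def D_def g_def g'_def)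
    have 3: "(I g' \<omega> - I g \<omega>) - (I h' \<omega> - I h \<omega>) = U \<omega> \<bullet> D - U \<omega> \<bullet> \<delta>"
      by (simp add: I_def D_def \<delta>_def inner_diff_right)
    have 4: "(norm (U \<omega> - x))\<^sup>2 = (norm (U \<omega>))\<^sup>2 - 2 * (U \<omega> \<bullet> x) + (norm x)\<^sup>2" for x
      by (simp add: power2_norm_eq_inner inner_diff_left inner_diff_right inner_commute)
    show ?thesis unfolding 1 2 3 \<delta> 4 by simp
  qed
  have "?l \<le> expectation (\<lambda>\<omega>. (norm (sp.gradF (W s t \<omega>) - V s t \<omega>))\<^sup>2 + (norm (V s (Suc t) \<omega> - V s t \<omega>))\<^sup>2
        + 2 * ((I g' \<omega> - I g \<omega>) - (I h' \<omega> - I h \<omega>)))"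
    using e d I pointwise by (intro integral_mono) auto
  also have "\<dots> = ?e + ?d + 2 * ((expectation (I g') - expectation (I g)) - (expectation (I h') - expectation (I h)))"
    using e d I by simp
  finally show ?thesis by (simp add: E)
qed

text \<open>Write \<open>d\<close> for the increment and v for the old direction. As the step is
  -\<eta> v, cocoercivity gives -d.v \<ge> (5/2)|d|^2. Then |v|^2 - |v + d|^2 = -2 d.v - |d|^2 is at
  least (5 - 1)|d|^2.\<close>

lemma V_increment_bound:
  assumes \<omega>: "\<omega> \<in> space P"
  shows "(norm (V s (Suc t) \<omega> - V s t \<omega>))\<^sup>2 \<le> ((norm (V s t \<omega>))\<^sup>2 - (norm (V s (Suc t) \<omega>))\<^sup>2) / 4"
proof -
  let ?z = "\<xi> (Suc s) (Suc t) \<omega>" and ?v = "V s t \<omega>"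
  define d where "d = sp.gradf (W s (Suc t) \<omega>) ?z - sp.gradf (W s t \<omega>) ?z"
  have v': "V s (Suc t) \<omega> = d + ?v" by (simp add: V_Suc d_def)
  interpret z: convex_smooth_function "\<lambda>u. f u ?z" L
    using sp.convex_smooth_f sample_space[OF sample_xi' \<omega>] .
  have "(norm d)\<^sup>2 \<le> L * (d \<bullet> (W s (Suc t) \<omega> - W s t \<omega>))"
    unfolding d_def by (rule z.cocoercive)
  also have "\<dots> = - (L * \<eta>) * (d \<bullet> ?v)"
    by (simp add: W_Suc)
  also have "L * \<eta> = 2 / 5"
    using sp.L_pos by (simp add: eta)
  finally have 1: "(norm d)\<^sup>2 \<le> - (2 / 5) * (d \<bullet> ?v)" .
  have 2: "(norm (d + ?v))\<^sup>2 = (norm d)\<^sup>2 + 2 * (d \<bullet> ?v) + (norm ?v)\<^sup>2"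
    by (simp add: power2_norm_eq_inner inner_add_left inner_add_right inner_commute)
  show ?thesis using 1 unfolding v' 2 by simp
qed

text \<open>The weight 1/4 matches the factor in \<open>V_increment_bound\<close>: whatever the
  error gains in one step is paid for by the decrease of the direction norm.\<close>

definition potential :: "nat \<Rightarrow> nat \<Rightarrow> real" where
  "potential s t = expectation (\<lambda>\<omega>. (norm (sp.gradF (W s t \<omega>) - V s t \<omega>))\<^sup>2)
     + expectation (\<lambda>\<omega>. (norm (V s t \<omega>))\<^sup>2) / 4"

lemma potential_Suc_le: "potential s (Suc t) \<le> potential s t"
proof -
  have V: "integrable P (\<lambda>\<omega>. (norm (V s t \<omega>))\<^sup>2)" for t by (intro square_integrableD V_sq)
  have "expectation (\<lambda>\<omega>. (norm (V s (Suc t) \<omega> - V s t \<omega>))\<^sup>2)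
      \<le> expectation (\<lambda>\<omega>. ((norm (V s t \<omega>))\<^sup>2 - (norm (V s (Suc t) \<omega>))\<^sup>2) / 4)"
    using V by (intro integral_mono V_increment_bound square_integrableD square_integrable_diff V_sq) auto
  also have "\<dots> = (expectation (\<lambda>\<omega>. (norm (V s t \<omega>))\<^sup>2) - expectation (\<lambda>\<omega>. (norm (V s (Suc t) \<omega>))\<^sup>2)) / 4"
    using V by simp
  finally show ?thesis
    using error_step[of s t] by (simp add: potential_def)
qed

lemma error_le_potential:
  "expectation (\<lambda>\<omega>. (norm (sp.gradF (W s t \<omega>) - V s t \<omega>))\<^sup>2) \<le> potential s 0"
proof -
  have "potential s t \<le> potential s 0"
    by (rule lift_Suc_antimono_le) (auto simp: potential_Suc_le)
  moreover have "0 \<le> expectation (\<lambda>\<omega>. (norm (V s t \<omega>))\<^sup>2)" by simp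
  ultimately show ?thesis unfolding potential_def[of s t] by linarith
qed

text \<open>A pointwise bound without expectations: the descent inequality at each inner step is
  telescoped over all \<open>m + 1\<close> steps, and the total decrease is at most the initial
  optimality gap, which \<open>polyak_lojasiewicz\<close> controls.\<close>

lemma sum_gradient_bound:
  "(\<Sum>t\<le>m. (norm (sp.gradF (W s t \<omega>)))\<^sup>2)
    \<le> (norm (sp.gradF (outer s \<omega>)))\<^sup>2 / (\<eta> * \<mu>) + (\<Sum>t\<le>m. (norm (sp.gradF (W s t \<omega>) - V s t \<omega>))\<^sup>2)"
proof -
  let ?F = "expected_loss M f"
  have eta_pos: "\<eta> > 0" using sp.L_pos by (simp add: eta)
  have "\<eta> / 2 * (norm (sp.gradF (W s t \<omega>)))\<^sup>2
      \<le> ?F (W s t \<omega>) - ?F (W s (Suc t) \<omega>) + \<eta> / 2 * (norm (sp.gradF (W s t \<omega>) - V s t \<omega>))\<^sup>2" for t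
  proof -
    let ?g = "sp.gradF (W s t \<omega>)" and ?v = "V s t \<omega>"
    have "W s (Suc t) \<omega> - W s t \<omega> = - (\<eta> *\<^sub>R ?v)" by (simp add: W_Suc)
    then have "?F (W s (Suc t) \<omega>) \<le> ?F (W s t \<omega>) - \<eta> * (?g \<bullet> ?v) + L / 2 * (\<eta>\<^sup>2 * (norm ?v)\<^sup>2)"
      using smooth_function.descent[OF sp.smooth_F, of "W s (Suc t) \<omega>" "W s t \<omega>"]
      by (simp add: power_mult_distrib)
    \<comment> \<open>As \<open>L * \<eta>\<close> is 2/5 < 1, the smoothness term is absorbed by
      the square of \<open>?v\<close> arising from polarization of the inner product.\<close>
    moreover have "L / 2 * (\<eta>\<^sup>2 * (norm ?v)\<^sup>2) = (2 / 5) * (\<eta> / 2 * (norm ?v)\<^sup>2)"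
      using sp.L_pos by (simp add: eta power2_eq_square)
    moreover have "0 \<le> \<eta> / 2 * (norm ?v)\<^sup>2" using eta_pos by simp
    moreover have "\<eta> / 2 * (norm (?g - ?v))\<^sup>2
        = \<eta> / 2 * (norm ?g)\<^sup>2 - \<eta> * (?g \<bullet> ?v) + \<eta> / 2 * (norm ?v)\<^sup>2"
      unfolding power2_norm_eq_inner
      by (simp add: inner_diff_left inner_diff_right inner_commute algebra_simps)
    ultimately show ?thesis by linarith
  qed
  then have "(\<Sum>t\<le>m. \<eta> / 2 * (norm (sp.gradF (W s t \<omega>)))\<^sup>2)
      \<le> (\<Sum>t\<le>m. ?F (W s t \<omega>) - ?F (W s (Suc t) \<omega>) + \<eta> / 2 * (norm (sp.gradF (W s t \<omega>) - V s t \<omega>))\<^sup>2)"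
    by (intro sum_mono)
  also have "\<dots> = ?F (W s 0 \<omega>) - ?F (W s (Suc m) \<omega>)
      + \<eta> / 2 * (\<Sum>t\<le>m. (norm (sp.gradF (W s t \<omega>) - V s t \<omega>))\<^sup>2)"
    using sum_telescope[of "\<lambda>t. ?F (W s t \<omega>)" m]
    by (simp only: sum.distrib sum_distrib_left)
  also have "?F (W s 0 \<omega>) - ?F (W s (Suc m) \<omega>) \<le> (norm (sp.gradF (outer s \<omega>)))\<^sup>2 / (2 * \<mu>)"
    using sp.polyak_lojasiewicz[of "outer s \<omega>"] sp.minimizer[of "W s (Suc m) \<omega>"] by (simp add: W_0)
  finally have "\<eta> / 2 * (\<Sum>t\<le>m. (norm (sp.gradF (W s t \<omega>)))\<^sup>2)
      \<le> \<eta> / 2 * ((norm (sp.gradF (outer s \<omega>)))\<^sup>2 / (\<eta> * \<mu>) + (\<Sum>t\<le>m. (norm (sp.gradF (W s t \<omega>) - V s t \<omega>))\<^sup>2))"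
    using eta_pos by (simp add: sum_distrib_left distrib_left)
  then show ?thesis using eta_pos by (simp only: mult_le_cancel_left_pos half_gt_zero)
qed

end

section \<open>Contraction of the outer iterates\<close>

context iSARAH_steps
begin

text \<open>The sample gradient \<open>h\<close> is compared with \<open>h0\<close> at the
  minimizer. Cocoercivity bounds the difference by inner products with \<open>X - wstar\<close>,
  whose means reduce to the full gradient. Subtracting the squared mean contributes the -1.\<close>

lemma gradf_variance:
  assumes Z: "sample k Z" and A: "A \<subseteq> sources b" "k \<notin> A"
    and X: "X \<in> borel_measurable (past A)" "square_integrable X"
  shows "expectation (\<lambda>\<omega>. (norm (sp.gradf (X \<omega>) (Z \<omega>) - sp.gradF (X \<omega>)))\<^sup>2)
    \<le> (2 * (L / \<mu>) - 1) * expectation (\<lambda>\<omega>. (norm (sp.gradF (X \<omega>)))\<^sup>2) + 2 * \<sigma>\<^sup>2"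
proof -
  define g where "g = (\<lambda>\<omega>. sp.gradF (X \<omega>))"
  define h where "h = (\<lambda>\<omega>. sp.gradf (X \<omega>) (Z \<omega>))"
  define h0 where "h0 = (\<lambda>\<omega>. sp.gradf wstar (Z \<omega>))"
  define U where "U = (\<lambda>\<omega>. X \<omega> - wstar)"
  have U: "U \<in> borel_measurable (past A)" "square_integrable U"
    unfolding U_def using X by (auto intro!: square_integrable_diff square_integrable_const)
  have g: "g \<in> borel_measurable (past A)" "square_integrable g"
    unfolding g_def using X by (auto intro!: gradF_past square_integrable_gradF)
  have sq: "square_integrable h" "square_integrable h0"
    unfolding h_def h0_def using X Z
    by (auto intro!: square_integrable_gradf square_integrable_const)
  note int = square_integrable_inner[OF U(2) sq(1)] square_integrable_inner[OF U(2) sq(2)]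
    square_integrable_inner[OF U(2) g(2)] square_integrable_inner[OF g(2) sq(1)]
    square_integrableD[OF g(2)] square_integrableD[OF sq(1)] square_integrableD[OF sq(2)]
  have gh: "expectation (\<lambda>\<omega>. g \<omega> \<bullet> h \<omega>) = expectation (\<lambda>\<omega>. (norm (g \<omega>))\<^sup>2)"
    unfolding power2_norm_eq_inner h_def
    using expectation_inner_gradf[OF Z A g X] by (simp add: g_def)
  have Uh: "expectation (\<lambda>\<omega>. U \<omega> \<bullet> h \<omega>) = expectation (\<lambda>\<omega>. U \<omega> \<bullet> g \<omega>)"
    unfolding h_def g_def by (rule expectation_inner_gradf[OF Z A U X])
  \<comment> \<open>The full gradient at \<open>wstar\<close> is zero, so this linear noise term has
    mean zero.\<close>
  have Uh0: "expectation (\<lambda>\<omega>. U \<omega> \<bullet> h0 \<omega>) = 0"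
    unfolding h0_def using expectation_inner_gradf[OF Z A U, of "\<lambda>_. wstar"]
    by (simp add: square_integrable_const sp.gradF_wstar)
  have "(norm (h \<omega>))\<^sup>2 \<le> 2 * (L * (U \<omega> \<bullet> h \<omega> - U \<omega> \<bullet> h0 \<omega>)) + 2 * (norm (h0 \<omega>))\<^sup>2"
    if \<omega>: "\<omega> \<in> space P" for \<omega>
  proof -
    interpret z: convex_smooth_function "\<lambda>u. f u (Z \<omega>)" L
      using sp.convex_smooth_f sample_space[OF Z \<omega>] .
    \<comment> \<open>This square is exactly the slack in |h|^2 \<le> 2|h - h0|^2 + 2|h0|^2.\<close>
    have "0 \<le> (h \<omega> - 2 *\<^sub>R h0 \<omega>) \<bullet> (h \<omega> - 2 *\<^sub>R h0 \<omega>)" by simp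
    then have "(norm (h \<omega>))\<^sup>2 \<le> 2 * (norm (h \<omega> - h0 \<omega>))\<^sup>2 + 2 * (norm (h0 \<omega>))\<^sup>2"
      unfolding power2_norm_eq_inner
      by (simp add: inner_diff_left inner_diff_right inner_commute)
    moreover have "(norm (h \<omega> - h0 \<omega>))\<^sup>2 \<le> L * ((h \<omega> - h0 \<omega>) \<bullet> U \<omega>)"
      unfolding h_def h0_def U_def by (rule z.cocoercive)
    moreover have "(h \<omega> - h0 \<omega>) \<bullet> U \<omega> = U \<omega> \<bullet> h \<omega> - U \<omega> \<bullet> h0 \<omega>"
      by (simp add: inner_diff_right inner_commute)
    ultimately show ?thesis by simp
  qed
  then have "expectation (\<lambda>\<omega>. (norm (h \<omega>))\<^sup>2)
      \<le> expectation (\<lambda>\<omega>. 2 * (L * (U \<omega> \<bullet> h \<omega> - U \<omega> \<bullet> h0 \<omega>)) + 2 * (norm (h0 \<omega>))\<^sup>2)"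
    using int by (intro integral_mono) auto
  also have "\<dots> = 2 * (L * expectation (\<lambda>\<omega>. U \<omega> \<bullet> g \<omega>)) + 2 * expectation (\<lambda>\<omega>. (norm (h0 \<omega>))\<^sup>2)"
    using int by (simp add: Uh Uh0)
  also have "expectation (\<lambda>\<omega>. (norm (h0 \<omega>))\<^sup>2) \<le> \<sigma>\<^sup>2"
    unfolding h0_def by (rule sample_noise(2)[OF Z])
  also have "expectation (\<lambda>\<omega>. U \<omega> \<bullet> g \<omega>) \<le> expectation (\<lambda>\<omega>. (norm (g \<omega>))\<^sup>2 / \<mu>)"
    using int sp.gradF_inner_le by (intro integral_mono) (auto simp: U_def g_def inner_commute)
  also have "\<dots> = expectation (\<lambda>\<omega>. (norm (g \<omega>))\<^sup>2) / \<mu>" by simp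
  finally have h: "expectation (\<lambda>\<omega>. (norm (h \<omega>))\<^sup>2)
      \<le> 2 * (L * (expectation (\<lambda>\<omega>. (norm (g \<omega>))\<^sup>2) / \<mu>)) + 2 * \<sigma>\<^sup>2"
    using sp.L_pos by simp
  have "expectation (\<lambda>\<omega>. (norm (h \<omega> - g \<omega>))\<^sup>2)
      = expectation (\<lambda>\<omega>. (norm (h \<omega>))\<^sup>2 - 2 * (g \<omega> \<bullet> h \<omega>) + (norm (g \<omega>))\<^sup>2)"
    by (intro arg_cong[where f=expectation])
       (simp add: fun_eq_iff power2_norm_eq_inner inner_diff_left inner_diff_right inner_commute)
  also have "\<dots> = expectation (\<lambda>\<omega>. (norm (h \<omega>))\<^sup>2) - expectation (\<lambda>\<omega>. (norm (g \<omega>))\<^sup>2)"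
    using int by (simp add: gh)
  finally show ?thesis
    using h unfolding h_def g_def by (simp add: algebra_simps)
qed

text \<open>The batch noises share the random point \<open>outer s\<close>, so their sum
  \<open>S\<close> is treated as a martingale: each increment is orthogonal to the past, and second
  moments add up. The mini-batch noise enters the error once and the direction norm with weight 1/4,
  giving 5/4.\<close>

lemma potential_0_le:
  fixes s
  defines "G \<equiv> expectation (\<lambda>\<omega>. (norm (sp.gradF (outer s \<omega>)))\<^sup>2)"
  defines "B \<equiv> (2 * (L / \<mu>) - 1) * G + 2 * \<sigma>\<^sup>2"
  shows "potential s 0 \<le> 5 / 4 * (B / real b) + G / 4"
proof -
  let ?X = "outer s"
  define g where "g = (\<lambda>\<omega>. sp.gradF (?X \<omega>))"
  define h where "h i = (\<lambda>\<omega>. sp.gradf (?X \<omega>) (\<zeta> (Suc s) i \<omega>))" for i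
  define S where "S k = (\<lambda>\<omega>. \<Sum>i = 1..k. h i \<omega> - g \<omega>)" for k
  have Z: "sample (Zeta (Suc s) i) (\<zeta> (Suc s) i)" if "i \<in> {1..b}" for i
    by (rule sample_zeta) (use that in auto)
  have X: "?X \<in> borel_measurable (past (history_zeta b s k))" for k
    by (rule measurable_past_mono[OF outer_measurable_past]) (auto simp: history_zeta_def)
  have X_sq: "square_integrable ?X" by (rule outer_square_integrable)
  have g: "g \<in> borel_measurable (past (history_zeta b s k))" "square_integrable g" for k
    unfolding g_def by (auto intro!: gradF_past X square_integrable_gradF X_sq)
  have h: "h i \<in> borel_measurable (past (history_zeta b s k))" if "i \<in> {1..k}" "k \<le> b" for i k
    unfolding h_def
    by (rule gradf_measurable_past[OF Z[of i] _ X]) (use that in \<open>auto simp: history_zeta_def\<close>)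
  have h_sq: "square_integrable (h i)" if "i \<in> {1..b}" for i
    unfolding h_def by (rule square_integrable_gradf[OF Z[OF that] X_sq])
  have S: "S k \<in> borel_measurable (past (history_zeta b s k))" if "k \<le> b" for k
    unfolding S_def using that by (intro borel_measurable_sum borel_measurable_diff h g) auto
  have S_sq: "square_integrable (S k)" if "k \<le> b" for k
    unfolding S_def using that by (intro square_integrable_sum square_integrable_diff h_sq g) auto
  have S_Suc: "S (Suc k) = (\<lambda>\<omega>. S k \<omega> + (h (Suc k) \<omega> - g \<omega>))" for k
    by (simp add: S_def sum_upto_Suc_eq)
  \<comment> \<open>Applied with \<open>Y\<close> equal to \<open>g\<close> and to the partial sum
    \<open>S k\<close>.\<close>
  have orth: "expectation (\<lambda>\<omega>. Y \<omega> \<bullet> (h (Suc k) \<omega> - g \<omega>)) = 0"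
    if "Suc k \<le> b" and Y: "Y \<in> borel_measurable (past (history_zeta b s k))" "square_integrable Y" for k Y
  proof -
    have k: "Suc k \<in> {1..b}" "k \<le> b" using that by auto
    have "expectation (\<lambda>\<omega>. Y \<omega> \<bullet> (h (Suc k) \<omega> - g \<omega>))
        = expectation (\<lambda>\<omega>. Y \<omega> \<bullet> h (Suc k) \<omega>) - expectation (\<lambda>\<omega>. Y \<omega> \<bullet> g \<omega>)"
      using square_integrable_inner[OF Y(2) h_sq[OF k(1)]] square_integrable_inner[OF Y(2) g(2)]
      by (simp add: inner_diff_right)
    also have "\<dots> = 0"
      unfolding h_def g_def
      using expectation_inner_gradf[OF Z[OF k(1)] history_subset(2)[OF k(2)] history_fresh(1) Y X X_sq] by simp
    finally show ?thesis .
  qed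
  have gS: "expectation (\<lambda>\<omega>. g \<omega> \<bullet> S k \<omega>) = 0" if "k \<le> b" for k
    using that
  proof (induction k)
    case (Suc k)
    then have "expectation (\<lambda>\<omega>. g \<omega> \<bullet> S (Suc k) \<omega>)
        = expectation (\<lambda>\<omega>. g \<omega> \<bullet> S k \<omega>) + expectation (\<lambda>\<omega>. g \<omega> \<bullet> (h (Suc k) \<omega> - g \<omega>))"
      unfolding S_Suc inner_add_right
      by (intro Bochner_Integration.integral_add square_integrable_inner g S_sq
          square_integrable_diff h_sq) auto
    with Suc orth[OF _ g] show ?case by simp
  qed (simp add: S_def)
  have SS: "expectation (\<lambda>\<omega>. (norm (S k \<omega>))\<^sup>2) \<le> real k * B" if "k \<le> b" for k
    using that
  proof (induction k)
    case (Suc k)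
    then have k: "Suc k \<in> {1..b}" "k \<le> b" by auto
    let ?n = "\<lambda>\<omega>. h (Suc k) \<omega> - g \<omega>"
    have n: "square_integrable ?n" by (intro square_integrable_diff h_sq g k)
    have "expectation (\<lambda>\<omega>. (norm (S (Suc k) \<omega>))\<^sup>2)
        = expectation (\<lambda>\<omega>. (norm (S k \<omega>))\<^sup>2 + 2 * (S k \<omega> \<bullet> ?n \<omega>) + (norm (?n \<omega>))\<^sup>2)"
      unfolding S_Suc power2_norm_eq_inner
      by (intro arg_cong[where f=expectation])
         (simp add: fun_eq_iff inner_add_left inner_add_right inner_commute)
    also have "\<dots> = expectation (\<lambda>\<omega>. (norm (S k \<omega>))\<^sup>2) + 2 * expectation (\<lambda>\<omega>. S k \<omega> \<bullet> ?n \<omega>)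
        + expectation (\<lambda>\<omega>. (norm (?n \<omega>))\<^sup>2)"
      using square_integrable_inner[OF S_sq[OF k(2)] n] square_integrableD[OF n]
        square_integrableD[OF S_sq[OF k(2)]] by simp
    also have "expectation (\<lambda>\<omega>. S k \<omega> \<bullet> ?n \<omega>) = 0"
      using orth[OF _ S[OF k(2)] S_sq[OF k(2)]] Suc.prems by simp
    also have "expectation (\<lambda>\<omega>. (norm (?n \<omega>))\<^sup>2) \<le> B"
      unfolding B_def G_def h_def g_def
      by (rule gradf_variance[OF Z[OF k(1)] history_subset(2)[OF k(2)] history_fresh(1) X X_sq])
    finally show ?case using Suc.IH[OF k(2)] by (simp add: algebra_simps)
  qed (simp add: S_def)
  have b: "real b > 0" using b_pos by simp
  have "V s 0 \<omega> = g \<omega> + (1 / real b) *\<^sub>R S b \<omega>" for \<omega>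
  proof -
    have "S b \<omega> = (\<Sum>i = 1..b. h i \<omega>) - real b *\<^sub>R g \<omega>"
      by (simp add: S_def sum_subtractf sum_constant_scaleR del: sum_constant)
    then show ?thesis using b by (simp add: V_0 h_def scaleR_diff_right)
  qed
  then have V0: "V s 0 = (\<lambda>\<omega>. g \<omega> + (1 / real b) *\<^sub>R S b \<omega>)" by (simp add: fun_eq_iff)
  have "expectation (\<lambda>\<omega>. (norm (sp.gradF (W s 0 \<omega>) - V s 0 \<omega>))\<^sup>2)
      = expectation (\<lambda>\<omega>. (norm (S b \<omega>))\<^sup>2 / (real b)\<^sup>2)"
    unfolding W_0 V0 g_def using b by (simp add: power_divide)
  also have "\<dots> = expectation (\<lambda>\<omega>. (norm (S b \<omega>))\<^sup>2) / (real b)\<^sup>2" by simp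
  finally have 1: "expectation (\<lambda>\<omega>. (norm (sp.gradF (W s 0 \<omega>) - V s 0 \<omega>))\<^sup>2)
      = expectation (\<lambda>\<omega>. (norm (S b \<omega>))\<^sup>2) / (real b)\<^sup>2" .
  have "expectation (\<lambda>\<omega>. (norm (V s 0 \<omega>))\<^sup>2)
      = expectation (\<lambda>\<omega>. (norm (g \<omega>))\<^sup>2 + 2 / real b * (g \<omega> \<bullet> S b \<omega>) + (norm (S b \<omega>))\<^sup>2 / (real b)\<^sup>2)"
    unfolding V0 power2_norm_eq_inner
    by (intro arg_cong[where f=expectation])
       (simp add: fun_eq_iff inner_add_left inner_add_right inner_commute power2_eq_square)
  also have "\<dots> = G + expectation (\<lambda>\<omega>. (norm (S b \<omega>))\<^sup>2) / (real b)\<^sup>2"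
    using square_integrable_inner[OF g(2) S_sq[OF order_refl]] square_integrableD[OF g(2)]
      square_integrableD[OF S_sq[OF order_refl]] gS[OF order_refl]
    by (simp add: G_def g_def)
  finally have 2: "expectation (\<lambda>\<omega>. (norm (V s 0 \<omega>))\<^sup>2)
      = G + expectation (\<lambda>\<omega>. (norm (S b \<omega>))\<^sup>2) / (real b)\<^sup>2" .
  have "expectation (\<lambda>\<omega>. (norm (S b \<omega>))\<^sup>2) / (real b)\<^sup>2 \<le> real b * B / (real b)\<^sup>2"
    using SS[OF order_refl] by (intro divide_right_mono) auto
  also have "\<dots> = B / real b" using b by (simp add: power2_eq_square)
  finally have 3: "expectation (\<lambda>\<omega>. (norm (S b \<omega>))\<^sup>2) / (real b)\<^sup>2 \<le> B / real b" .
  have "x + (G + x) / 4 \<le> 5 / 4 * y + G / 4" if "x \<le> y" for x y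
    using that by (simp add: add_divide_distrib)
  from this[OF 3] show ?thesis unfolding potential_def 1 2 .
qed

definition mean_sq_grad :: "nat \<Rightarrow> real" where
  "mean_sq_grad s = expectation (\<lambda>\<omega>. (norm (sp.gradF (outer s \<omega>)))\<^sup>2)"

text \<open>The uniform output index turns the next outer value into the average of the squared
  gradients over the inner loop, to which the summed descent bound applies.\<close>

lemma mean_sq_grad_Suc_le:
  "mean_sq_grad (Suc s) \<le> mean_sq_grad s / ((real m + 1) * (\<eta> * \<mu>)) + potential s 0"
proof -
  let ?H = "\<lambda>t \<omega>. (norm (sp.gradF (W s t \<omega>)))\<^sup>2"
  let ?E = "\<lambda>t \<omega>. (norm (sp.gradF (W s t \<omega>) - V s t \<omega>))\<^sup>2"
  have H: "integrable P (?H t)" for t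
    by (intro square_integrableD square_integrable_gradF W_sq)
  have E: "integrable P (?E t)" for t
    by (intro square_integrableD square_integrable_diff square_integrable_gradF W_sq V_sq)
  have G: "integrable P (\<lambda>\<omega>. (norm (sp.gradF (outer s \<omega>)))\<^sup>2)"
    by (intro square_integrableD square_integrable_gradF outer_square_integrable)
  \<comment> \<open>A single source set must cover the gradients at all inner indices; the output
    index of this call is still outside it.\<close>
  let ?A = "\<Union>t. history_xi b s t"
  have "W s t \<in> borel_measurable (past ?A)" for t
    by (rule measurable_past_mono[OF W_past]) auto
  then have H_past: "?H t \<in> borel_measurable (past ?A)" for t
    by (intro borel_measurable_power measurable_compose[OF gradF_past borel_measurable_norm])
  have A: "?A \<subseteq> sources b" "Tau (Suc s) \<notin> ?A"
    using history_subset(3) history_fresh(3) by blast+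
  have mean_sq_grad: "mean_sq_grad (Suc s) = (\<Sum>t\<le>m. expectation (?H t)) / (real m + 1)"
    unfolding mean_sq_grad_def outer_Suc
    by (rule expectation_tau(2)[of "Suc s" ?A ?H, OF _ A H_past H]) simp
  have "(\<Sum>t\<le>m. expectation (?H t)) = expectation (\<lambda>\<omega>. \<Sum>t\<le>m. ?H t \<omega>)"
    using H by simp
  also have "\<dots> \<le> expectation (\<lambda>\<omega>. (norm (sp.gradF (outer s \<omega>)))\<^sup>2 / (\<eta> * \<mu>) + (\<Sum>t\<le>m. ?E t \<omega>))"
    using H E G by (intro integral_mono sum_gradient_bound) auto
  also have "\<dots> = mean_sq_grad s / (\<eta> * \<mu>) + (\<Sum>t\<le>m. expectation (?E t))"
  proof -
    have "expectation (\<lambda>\<omega>. \<Sum>t\<le>m. ?E t \<omega>) = (\<Sum>t\<le>m. expectation (?E t))"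
      by (rule Bochner_Integration.integral_sum) (rule E)
    moreover have "integrable P (\<lambda>\<omega>. \<Sum>t\<le>m. ?E t \<omega>)"
      by (rule Bochner_Integration.integrable_sum) (rule E)
    ultimately show ?thesis
      unfolding mean_sq_grad_def using G
      by (subst Bochner_Integration.integral_add) (simp_all only: integral_divide_zero integrable_divide_zero)
  qed
  also have "\<dots> \<le> mean_sq_grad s / (\<eta> * \<mu>) + (\<Sum>t\<le>m. potential s 0)"
    by (intro add_left_mono sum_mono error_le_potential)
  also have "\<dots> = mean_sq_grad s / (\<eta> * \<mu>) + (real m + 1) * potential s 0"
    by simp
  finally have "mean_sq_grad (Suc s) \<le> (mean_sq_grad s / (\<eta> * \<mu>) + (real m + 1) * potential s 0) / (real m + 1)"
    unfolding mean_sq_grad by (intro divide_right_mono) auto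
  also have "\<dots> = mean_sq_grad s / ((real m + 1) * (\<eta> * \<mu>)) + potential s 0"
    by (simp add: add_divide_distrib mult.commute)
  finally show ?thesis .
qed

text \<open>The first term has factor 1/8 because \<open>(real m + 1) * (\<eta> * \<mu>)\<close> is
  at least 20 * 2/5 = 8. The batch size bounds the initial variance by a tenth of the current value
  plus \<open>\<epsilon> / 10\<close>; times 5/4 these are 1/8 each, and the remaining 1/4 comes
  from the potential.\<close>

lemma mean_sq_grad_contraction:
  assumes m: "20 * (L / \<mu>) \<le> real m + 1" and b: "20 * (L / \<mu>) - 10 \<le> real b"
    and b\<epsilon>: "20 * \<sigma>\<^sup>2 \<le> \<epsilon> * real b"
  shows "mean_sq_grad (Suc s) \<le> mean_sq_grad s / 2 + \<epsilon> / 8"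
proof -
  have b0: "real b > 0" using b_pos by simp
  have mean_sq_grad: "mean_sq_grad s \<ge> 0" by (simp add: mean_sq_grad_def)
  have "8 \<le> (real m + 1) * (\<eta> * \<mu>)"
    using m sp.L_pos sp.mu_pos by (simp add: eta field_simps)
  then have 1: "mean_sq_grad s / ((real m + 1) * (\<eta> * \<mu>)) \<le> mean_sq_grad s / 8"
    using mean_sq_grad by (intro divide_left_mono) auto
  have "(2 * (L / \<mu>) - 1) * mean_sq_grad s \<le> (real b / 10) * mean_sq_grad s"
    using b mean_sq_grad by (intro mult_right_mono) auto
  moreover have "(mean_sq_grad s / 10 + \<epsilon> / 10) * real b = (real b / 10) * mean_sq_grad s + \<epsilon> * real b / 10"
    by (simp add: distrib_right)
  ultimately have "(2 * (L / \<mu>) - 1) * mean_sq_grad s + 2 * \<sigma>\<^sup>2 \<le> (mean_sq_grad s / 10 + \<epsilon> / 10) * real b"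
    using b\<epsilon> by simp
  then have "((2 * (L / \<mu>) - 1) * mean_sq_grad s + 2 * \<sigma>\<^sup>2) / real b \<le> mean_sq_grad s / 10 + \<epsilon> / 10"
    using b0 by (simp only: pos_divide_le_eq)
  then show ?thesis
    using mean_sq_grad_Suc_le[of s] potential_0_le[of s] 1 unfolding mean_sq_grad_def[symmetric] by linarith
qed

text \<open>The offset \<open>\<epsilon> / 4\<close> is the fixed point of x = x/2 + \<epsilon>/8,
  so only the distance to it is halved in each outer step.\<close>

lemma mean_sq_grad_le:
  assumes "20 * (L / \<mu>) \<le> real m + 1" "20 * (L / \<mu>) - 10 \<le> real b" "20 * \<sigma>\<^sup>2 \<le> \<epsilon> * real b"
    and "\<epsilon> \<ge> 0"
  shows "mean_sq_grad s \<le> (norm (sp.gradF w0))\<^sup>2 / 2 ^ s + \<epsilon> / 4"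
proof -
  define q where "q k = (norm (sp.gradF w0))\<^sup>2 / 2 ^ k" for k
  have q_Suc: "q (Suc k) = q k / 2" for k by (simp add: q_def)
  have "mean_sq_grad s \<le> q s + \<epsilon> / 4"
  proof (induction s)
    case 0
    then show ?case using \<open>\<epsilon> \<ge> 0\<close> by (simp add: mean_sq_grad_def q_def prob_space)
  next
    case (Suc s)
    then show ?case using mean_sq_grad_contraction[OF assms(1-3), of s] q_Suc[of s] by linarith
  qed
  then show ?thesis by (simp add: q_def)
qed

lemma integrable_mean_sq_grad: "integrable P (\<lambda>\<omega>. (norm (sp.gradF (outer s \<omega>)))\<^sup>2)"
  by (intro square_integrableD square_integrable_gradF outer_square_integrable)

end

section \<open>Number of outer steps and count of the total work\<close>

lemma work_complexity_arith:
  fixes \<kappa> \<epsilon> \<sigma> G :: real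
  assumes \<kappa>: "\<kappa> \<ge> 1" and \<epsilon>: "0 < \<epsilon>" "\<epsilon> < min (1 / 2) (3 / (4 * (\<bar>G\<bar> + 1)))"
  defines "m \<equiv> nat \<lceil>20 * \<kappa> - 1\<rceil>"
    and "b \<equiv> nat \<lceil>max (20 * \<kappa> - 10) (20 * \<sigma>\<^sup>2 / \<epsilon>)\<rceil>"
    and "s \<equiv> nat \<lceil>2 * log 2 (1 / \<epsilon>)\<rceil>"
  shows "20 * \<kappa> \<le> real m + 1" "20 * \<kappa> - 10 \<le> real b" "20 * \<sigma>\<^sup>2 \<le> \<epsilon> * real b" "b > 0"
    and "G / 2 ^ s + \<epsilon> / 4 \<le> \<epsilon>"
    and "real ((b + m) * s) \<le> 250 * (max (\<sigma>\<^sup>2 / \<epsilon>) \<kappa> * ln (1 / \<epsilon>))"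
proof -
  let ?M = "max (\<sigma>\<^sup>2 / \<epsilon>) \<kappa>" and ?l = "log 2 (1 / \<epsilon>)"
  show m: "20 * \<kappa> \<le> real m + 1" unfolding m_def by linarith
  have b: "max (20 * \<kappa> - 10) (20 * \<sigma>\<^sup>2 / \<epsilon>) \<le> real b" unfolding b_def by linarith
  then show b1: "20 * \<kappa> - 10 \<le> real b" by simp
  then have "real b > 0" using \<kappa> by linarith
  then show "b > 0" by simp
  have "20 * \<sigma>\<^sup>2 / \<epsilon> \<le> real b" using b by simp
  then show "20 * \<sigma>\<^sup>2 \<le> \<epsilon> * real b" using \<epsilon> by (simp add: field_simps)
  have half: "2 \<le> 1 / \<epsilon>" using \<epsilon> by (simp add: field_simps)
  then have "log 2 2 \<le> ?l" using \<epsilon> by (subst log_le_cancel_iff) auto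
  then have l: "1 \<le> ?l" by simp
  have s: "2 * ?l \<le> real s" "real s \<le> 3 * ?l" unfolding s_def using l by linarith+
  \<comment> \<open>Doubling the logarithm gains a second factor \<open>\<epsilon>\<close>. It
    absorbs the initial gradient \<open>G\<close> through the threshold on
    \<open>\<epsilon>\<close>, so that the work constant does not depend on
    \<open>G\<close>.\<close>
  have "1 / \<epsilon>\<^sup>2 = 2 powr (2 * ?l)"
    using \<epsilon> by (simp add: powr_powr[symmetric] mult.commute[of 2] powr_realpow power_divide)
  also have "\<dots> \<le> 2 powr (real s)" using s by simp
  finally have pow: "1 / \<epsilon>\<^sup>2 \<le> 2 ^ s" by (simp add: powr_realpow)
  \<comment> \<open>No sign is assumed for \<open>G\<close>; \<open>\<bar>G\<bar> + 1\<close> is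
    positive in every case.\<close>
  have "G / 2 ^ s \<le> (\<bar>G\<bar> + 1) / 2 ^ s" by (intro divide_right_mono) auto
  also have "\<dots> \<le> (\<bar>G\<bar> + 1) / (1 / \<epsilon>\<^sup>2)" using pow \<epsilon> by (intro divide_left_mono) auto
  also have "\<dots> = ((\<bar>G\<bar> + 1) * \<epsilon>) * \<epsilon>" by (simp add: power2_eq_square)
  also have "(\<bar>G\<bar> + 1) * \<epsilon> \<le> 3 / 4"
  proof -
    have "\<epsilon> < 3 / (4 * (\<bar>G\<bar> + 1))" using \<epsilon> by simp
    then show ?thesis by (simp add: field_simps)
  qed
  finally have "G / 2 ^ s \<le> 3 / 4 * \<epsilon>" using \<epsilon> by (simp add: mult_right_mono)
  from add_right_mono[OF this, of "\<epsilon> / 4"] show "G / 2 ^ s + \<epsilon> / 4 \<le> \<epsilon>" by simp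
  have M: "\<sigma>\<^sup>2 / \<epsilon> \<le> ?M" "\<kappa> \<le> ?M" by auto
  have "max (20 * \<kappa> - 10) (20 * \<sigma>\<^sup>2 / \<epsilon>) \<le> 20 * ?M"
    using M by (intro max.boundedI) auto
  then have "real b \<le> 20 * ?M + 1" unfolding b_def using M \<kappa> by linarith
  moreover have "real m \<le> 20 * \<kappa>" unfolding m_def using \<kappa> by linarith
  \<comment> \<open>20 + 20 from the two parameters, and 1 from rounding \<open>b\<close> up, since
    \<open>?M\<close> is at least 1.\<close>
  ultimately have bm: "real b + real m \<le> 41 * ?M" using M \<kappa> by linarith
  have "ln 2 \<ge> (1 / 2 :: real)" using ln2_ge_two_thirds by simp
  then have "?l \<le> 2 * ln (1 / \<epsilon>)"
  proof -
    assume ln2: "ln 2 \<ge> (1 / 2 :: real)"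
    have "ln (1 / \<epsilon>) \<ge> 0" using half by simp
    then have "ln (1 / \<epsilon>) / ln 2 \<le> ln (1 / \<epsilon>) / (1 / 2)"
      using ln2 by (intro divide_left_mono) auto
    then show ?thesis by (simp add: log_def)
  qed
  \<comment> \<open>Rounding raises the factor 2 to 3, as the binary logarithm is at least 1;
    changing to \<open>ln\<close> costs another factor 2.\<close>
  then have "real s \<le> 6 * ln (1 / \<epsilon>)" using s by linarith
  then have "(real b + real m) * real s \<le> (41 * ?M) * (6 * ln (1 / \<epsilon>))"
    using bm M \<kappa> by (intro mult_mono) auto
  also have "\<dots> = 246 * (?M * ln (1 / \<epsilon>))" by simp
  also have "\<dots> \<le> 250 * (?M * ln (1 / \<epsilon>))"
    using half M \<kappa> by (intro mult_right_mono mult_nonneg_nonneg) auto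
  finally show "real ((b + m) * s) \<le> 250 * (?M * ln (1 / \<epsilon>))" by simp
qed

text \<open>\<open>G\<close> is fixed before the constants, which expresses their permitted
  dependence on the initial gradient. \<open>s\<close> is chosen before the probability space.
  Integrability is asserted as well because the integral of a non-integrable function is 0 by
  convention, which would make the bound hollow.\<close>

theorem corollary4:
  fixes G :: real
  shows "\<exists>C > 0. \<exists>\<epsilon>0 > 0.
    \<forall>(M :: 'a measure) (f :: real ^ 'd \<Rightarrow> 'a \<Rightarrow> real) L \<mu> \<sigma> wstar w0 \<epsilon>.
      stochastic_problem M f L \<mu> \<sigma> wstar \<longrightarrow>
      (norm (grad (expected_loss M f) w0))\<^sup>2 = G \<longrightarrow>
      0 < \<epsilon> \<longrightarrow> \<epsilon> < \<epsilon>0 \<longrightarrow>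
      (let \<kappa> = L / \<mu>;
           \<eta> = 2 / (5 * L);
           m = nat \<lceil>20 * \<kappa> - 1\<rceil>;
           b = nat \<lceil>max (20 * \<kappa> - 10) (20 * \<sigma>\<^sup>2 / \<epsilon>)\<rceil>
       in \<exists>s :: nat.
            (\<forall>(P :: '\<omega> measure) \<zeta> \<xi> \<tau>. iSARAH_randomness P M m b \<zeta> \<xi> \<tau> \<longrightarrow>
               integrable P (\<lambda>\<omega>. (norm (grad (expected_loss M f) (iSARAH f \<eta> b w0 \<zeta> \<xi> \<tau> s \<omega>)))\<^sup>2) \<and>
               (\<integral>\<omega>. (norm (grad (expected_loss M f) (iSARAH f \<eta> b w0 \<zeta> \<xi> \<tau> s \<omega>)))\<^sup>2 \<partial>P) \<le> \<epsilon>) \<and>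
            real ((b + m) * s) \<le> C * (max (\<sigma>\<^sup>2 / \<epsilon>) \<kappa> * ln (1 / \<epsilon>)))"
proof (rule exI[of _ 250], intro conjI, simp,
    rule exI[of _ "min (1 / 2) (3 / (4 * (\<bar>G\<bar> + 1)))"], intro conjI allI impI)
  show "0 < min (1 / 2) (3 / (4 * (\<bar>G\<bar> + 1)))" by simp
next
  fix M :: "'a measure" and f :: "real ^ 'd \<Rightarrow> 'a \<Rightarrow> real" and L \<mu> \<sigma> wstar w0 \<epsilon>
  assume prob: "stochastic_problem M f L \<mu> \<sigma> wstar"
    and G: "(norm (grad (expected_loss M f) w0))\<^sup>2 = G"
    and \<epsilon>: "0 < \<epsilon>" "\<epsilon> < min (1 / 2) (3 / (4 * (\<bar>G\<bar> + 1)))"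
  interpret sp: stochastic_problem M f L \<mu> \<sigma> wstar by fact
  define \<kappa> where "\<kappa> = L / \<mu>"
  define \<eta> where "\<eta> = 2 / (5 * L)"
  define m where "m = nat \<lceil>20 * \<kappa> - 1\<rceil>"
  define b where "b = nat \<lceil>max (20 * \<kappa> - 10) (20 * \<sigma>\<^sup>2 / \<epsilon>)\<rceil>"
  define s where "s = nat \<lceil>2 * log 2 (1 / \<epsilon>)\<rceil>"
  have \<kappa>: "\<kappa> \<ge> 1" using sp.mu_le_L sp.mu_pos by (simp add: \<kappa>_def)
  note m_bound = work_complexity_arith(1)[OF \<kappa> \<epsilon>, folded m_def]
    and b_bounds = work_complexity_arith(2-4)[OF \<kappa> \<epsilon>, of \<sigma>, folded b_def]
    and final_mean_sq_grad = work_complexity_arith(5)[OF \<kappa> \<epsilon>, folded s_def]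
    and work = work_complexity_arith(6)[OF \<kappa> \<epsilon>, of \<sigma>, folded m_def b_def s_def]
  have "integrable P (\<lambda>\<omega>. (norm (grad (expected_loss M f) (iSARAH f \<eta> b w0 \<zeta> \<xi> \<tau> s \<omega>)))\<^sup>2) \<and>
      (\<integral>\<omega>. (norm (grad (expected_loss M f) (iSARAH f \<eta> b w0 \<zeta> \<xi> \<tau> s \<omega>)))\<^sup>2 \<partial>P) \<le> \<epsilon>"
    if run: "iSARAH_randomness P M m b \<zeta> \<xi> \<tau>" for P :: "'\<omega> measure" and \<zeta> \<xi> \<tau>
  proof -
    interpret run: iSARAH_randomness P M m b \<zeta> \<xi> \<tau> by fact
    interpret run: iSARAH_steps P M f L \<mu> \<sigma> wstar m b \<zeta> \<xi> \<tau> w0 \<eta>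
      by unfold_locales (auto simp: \<eta>_def b_bounds)
    have "run.mean_sq_grad s \<le> G / 2 ^ s + \<epsilon> / 4"
      using run.mean_sq_grad_le[of \<epsilon> s] m_bound b_bounds \<epsilon> by (simp add: \<kappa>_def G)
    then show ?thesis
      using final_mean_sq_grad run.integrable_mean_sq_grad[of s] by (simp add: run.mean_sq_grad_def)
  qed
  then show "let \<kappa> = L / \<mu>; \<eta> = 2 / (5 * L); m = nat \<lceil>20 * \<kappa> - 1\<rceil>;
           b = nat \<lceil>max (20 * \<kappa> - 10) (20 * \<sigma>\<^sup>2 / \<epsilon>)\<rceil>
       in \<exists>s :: nat.
            (\<forall>(P :: '\<omega> measure) \<zeta> \<xi> \<tau>. iSARAH_randomness P M m b \<zeta> \<xi> \<tau> \<longrightarrow>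
               integrable P (\<lambda>\<omega>. (norm (grad (expected_loss M f) (iSARAH f \<eta> b w0 \<zeta> \<xi> \<tau> s \<omega>)))\<^sup>2) \<and>
               (\<integral>\<omega>. (norm (grad (expected_loss M f) (iSARAH f \<eta> b w0 \<zeta> \<xi> \<tau> s \<omega>)))\<^sup>2 \<partial>P) \<le> \<epsilon>) \<and>
            real ((b + m) * s) \<le> 250 * (max (\<sigma>\<^sup>2 / \<epsilon>) \<kappa> * ln (1 / \<epsilon>))"
    unfolding Let_def \<kappa>_def[symmetric] \<eta>_def[symmetric] m_def[symmetric] b_def[symmetric]
    using work by blast
qed

end
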